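(* Let $k$ be a differential field of characteristic $0$ with commuting derivations $\delta_1,\ldots,\delta_m$, and let $A=k\{x,y\}$ be the algebra of differential polynomials over $k$ in two variables. Then every tame automorphism of $A$ that is not affine is elementarily reducible.
   Context: Let $\Delta=\{\delta_1,\ldots,\delta_m\}$ be a finite set of symbols for derivations ($m\ge 0$), and let $\Theta$ be the free commutative monoid on $\Delta$; for $\theta=\delta_1^{i_1}\cdots\delta_m^{i_m}$ put $|\theta|=i_1+\ldots+i_m$. A differential field is a field on which $\delta_1,\ldots,\delta_m$ act as pairwise commuting derivations. $k\{x,y\}$ denotes the polynomial algebra $k[x^\theta,y^\theta \mid \theta\in\Theta]$ in the algebraically independent variables $x^\theta,y^\theta$, with $x=x^1$, $y=y^1$, made into a differential algebra by the given action of $\delta_i$ on $k$ and $\delta_i(x^\theta)=x^{\theta\delta_i}$, $\delta_i(y^\theta)=y^{\theta\delta_i}$. $k\{y\}$ and $k\{x\}$ are the analogous one-variable algebras. For $f\in A$, $k\{f\}$ denotes the differential $k$-subalgebra of $A$ generated by $f$. Degree: $\deg(x^\theta)=\deg(y^\theta)=1+|\theta|$, the degree of a monomial (product of such variables) is the sum of the degrees of its factors, and $\deg(f)$ for $0\ne f\in A$ is the largest degree of a monomial occurring in $f$ with nonzero coefficient. $Aut(A)$ is the group of automorphisms of $A$ as a differential $k$-algebra ($k$-algebra automorphisms commuting with all $\delta_i$). An automorphism $\varphi$ is written $\varphi=(f_1,f_2)$ where $\varphi(x)=f_1$, $\varphi(y)=f_2$, and $\deg(\varphi)=\deg(f_1)+\deg(f_2)$.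 Elementary automorphisms are those of the form $(ax+f(y),y)$ or $(x,ay+g(x))$ with $0\ne a\in k$, $f(y)\in k\{y\}$, $g(x)\in k\{x\}$. An automorphism is tame if it lies in the subgroup generated by all elementary automorphisms. Affine automorphisms are those of the form $(a_1x+b_1y+c_1,\,a_2x+b_2y+c_2)$ with $a_i,b_i,c_i\in k$, $a_1b_2\ne a_2b_1$. An elementary transformation of a pair $(f_1,f_2)$ replaces exactly one element $f_i$ ($i=1,2$) by $\alpha f_i+g$, where $0\ne\alpha\in k$ and $g\in k\{f_j\}$, $j\neq i$. Write $\theta\to\varphi$ if the automorphism $\varphi$ is obtained from the automorphism $\theta$ by one elementary transformation. An automorphism $\theta$ is elementarily reducible if there is an automorphism $\varphi$ with $\theta\to\varphi$ and $\deg(\varphi)<\deg(\theta)$. *)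

theory Defs
  imports
    "HOL-Library.Poly_Mapping"
    "HOL-Library.Multiset"
    "HOL-Algebra.Bij"
    "HOL-Algebra.Generated_Groups"
begin

text \<open>
  The derivation symbols are the indices \<open>1, \<dots>, m\<close>, so \<open>m = 0\<close> is allowed, and
  \<open>\<delta> i\<close> is the action of the \<open>i\<close>-th symbol on the base field.
\<close>

definition derivation :: "('k::comm_ring_1 \<Rightarrow> 'k) \<Rightarrow> bool" where
  "derivation d \<longleftrightarrow> (\<forall>a b. d (a + b) = d a + d b) \<and> (\<forall>a b. d (a * b) = d a * b + a * d b)"

definition differential_field :: "nat \<Rightarrow> (nat \<Rightarrow> 'k::field \<Rightarrow> 'k) \<Rightarrow> bool" where
  "differential_field m \<delta> \<longleftrightarrow>
     (\<forall>i\<in>{1..m}. derivation (\<delta> i)) \<and>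
     (\<forall>i\<in>{1..m}. \<forall>j\<in>{1..m}. \<forall>a. \<delta> i (\<delta> j a) = \<delta> j (\<delta> i a))"

text \<open>
  Elements of the free commutative monoid \<open>\<Theta>\<close> are finite multisets of derivation symbols, with
  \<open>\<bar>\<theta>\<bar> = size \<theta>\<close>. The pair \<open>(z, \<theta>)\<close> stands for the variable \<open>z\<^sup>\<theta>\<close>, a
  monomial is a finite multiset of variables, and a polynomial maps monomials to coefficients.
  The type contains variables \<open>z\<^sup>\<theta>\<close> with symbols outside \<open>{1..m}\<close>; these are excluded by
  the carrier set \<open>diff_polys\<close>.
\<close>

datatype indet = X | Y

type_synonym dvar = "indet \<times> nat multiset"
type_synonym 'k dpoly = "dvar multiset \<Rightarrow>\<^sub>0 'k"

text \<open>
  \<open>diff_polys m {X, Y}\<close> is \<open>k{x,y}\<close>, while \<open>diff_polys m {X}\<close> and \<open>diff_polys m {Y}\<close> are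
  \<open>k{x}\<close> and \<open>k{y}\<close> as subsets of \<open>k{x,y}\<close>.
\<close>

definition diff_polys :: "nat \<Rightarrow> indet set \<Rightarrow> 'k::field dpoly set" where
  "diff_polys m Z =
     {f. \<forall>u\<in>Poly_Mapping.keys f. \<forall>(z, \<theta>)\<in>set_mset u. z \<in> Z \<and> set_mset \<theta> \<subseteq> {1..m}}"

abbreviation dp_algebra :: "nat \<Rightarrow> 'k::field dpoly set" where
  "dp_algebra m \<equiv> diff_polys m {X, Y}"

definition Const :: "'k::field \<Rightarrow> 'k dpoly" where
  "Const c = Poly_Mapping.single {#} c"

definition dp_var :: "dvar \<Rightarrow> 'k::field dpoly" where
  "dp_var v = Poly_Mapping.single {#v#} 1"

definition dp_x :: "'k::field dpoly" where
  "dp_x = dp_var (X, {#})"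

definition dp_y :: "'k::field dpoly" where
  "dp_y = dp_var (Y, {#})"

definition shift :: "nat \<Rightarrow> dvar \<Rightarrow> dvar" where
  "shift i v = (fst v, add_mset i (snd v))"

text \<open>
  Leibniz rule on \<open>c \<sqdot> v\<^sub>1 \<sqdot> \<dots> \<sqdot> v\<^sub>r\<close>, extended additively to all polynomials.
\<close>

definition dp_deriv :: "(nat \<Rightarrow> 'k::field \<Rightarrow> 'k) \<Rightarrow> nat \<Rightarrow> 'k dpoly \<Rightarrow> 'k dpoly" where
  "dp_deriv \<delta> i f = (\<Sum>u\<in>Poly_Mapping.keys f.
     Poly_Mapping.single u (\<delta> i (Poly_Mapping.lookup f u)) +
     (\<Sum>v\<in>#u. Poly_Mapping.single (add_mset (shift i v) (u - {#v#})) (Poly_Mapping.lookup f u)))"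

inductive_set diff_subalgebra ::
    "nat \<Rightarrow> (nat \<Rightarrow> 'k::field \<Rightarrow> 'k) \<Rightarrow> 'k dpoly \<Rightarrow> 'k dpoly set"
  for m :: nat and \<delta> :: "nat \<Rightarrow> 'k \<Rightarrow> 'k" and f :: "'k dpoly" where
  gen: "f \<in> diff_subalgebra m \<delta> f"
| const: "Const c \<in> diff_subalgebra m \<delta> f"
| add: "g \<in> diff_subalgebra m \<delta> f \<Longrightarrow> h \<in> diff_subalgebra m \<delta> f \<Longrightarrow> g + h \<in> diff_subalgebra m \<delta> f"
| mult: "g \<in> diff_subalgebra m \<delta> f \<Longrightarrow> h \<in> diff_subalgebra m \<delta> f \<Longrightarrow> g * h \<in> diff_subalgebra m \<delta> f"
| deriv: "g \<in> diff_subalgebra m \<delta> f \<Longrightarrow> i \<in> {1..m} \<Longrightarrow> dp_deriv \<delta> i g \<in> diff_subalgebra m \<delta> f"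

definition mon_deg :: "dvar multiset \<Rightarrow> nat" where
  "mon_deg u = (\<Sum>v\<in>#u. 1 + size (snd v))"

text \<open>The value at \<open>0\<close>, which the mathematics leaves undefined, is \<open>0\<close> here.\<close>

definition dp_deg :: "'k::field dpoly \<Rightarrow> nat" where
  "dp_deg f = (if f = 0 then 0 else Max (mon_deg ` Poly_Mapping.keys f))"

text \<open>
  As in \<^const>\<open>Bij\<close>, an automorphism is a function that is \<open>undefined\<close> outside the carrier set.
\<close>

definition dp_auto :: "nat \<Rightarrow> (nat \<Rightarrow> 'k::field \<Rightarrow> 'k) \<Rightarrow> ('k dpoly \<Rightarrow> 'k dpoly) set" where
  "dp_auto m \<delta> = {\<phi> \<in> Bij (dp_algebra m).
     (\<forall>f\<in>dp_algebra m. \<forall>g\<in>dp_algebra m. \<phi> (f + g) = \<phi> f + \<phi> g) \<and>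
     (\<forall>f\<in>dp_algebra m. \<forall>g\<in>dp_algebra m. \<phi> (f * g) = \<phi> f * \<phi> g) \<and>
     (\<forall>c. \<phi> (Const c) = Const c) \<and>
     (\<forall>i\<in>{1..m}. \<forall>f\<in>dp_algebra m. \<phi> (dp_deriv \<delta> i f) = dp_deriv \<delta> i (\<phi> f))}"

definition dp_AutoGroup :: "nat \<Rightarrow> (nat \<Rightarrow> 'k::field \<Rightarrow> 'k) \<Rightarrow> ('k dpoly \<Rightarrow> 'k dpoly) monoid" where
  "dp_AutoGroup m \<delta> = BijGroup (dp_algebra m) \<lparr>carrier := dp_auto m \<delta>\<rparr>"

definition auto_pair :: "('k::field dpoly \<Rightarrow> 'k dpoly) \<Rightarrow> 'k dpoly \<times> 'k dpoly" where
  "auto_pair \<phi> = (\<phi> dp_x, \<phi> dp_y)"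

definition auto_deg :: "('k::field dpoly \<Rightarrow> 'k dpoly) \<Rightarrow> nat" where
  "auto_deg \<phi> = dp_deg (\<phi> dp_x) + dp_deg (\<phi> dp_y)"

definition elementary_autos :: "nat \<Rightarrow> (nat \<Rightarrow> 'k::field \<Rightarrow> 'k) \<Rightarrow> ('k dpoly \<Rightarrow> 'k dpoly) set" where
  "elementary_autos m \<delta> = {\<phi> \<in> dp_auto m \<delta>.
     (\<exists>a f. a \<noteq> 0 \<and> f \<in> diff_polys m {Y} \<and> auto_pair \<phi> = (Const a * dp_x + f, dp_y)) \<or>
     (\<exists>a g. a \<noteq> 0 \<and> g \<in> diff_polys m {X} \<and> auto_pair \<phi> = (dp_x, Const a * dp_y + g))}"

definition tame_autos :: "nat \<Rightarrow> (nat \<Rightarrow> 'k::field \<Rightarrow> 'k) \<Rightarrow> ('k dpoly \<Rightarrow> 'k dpoly) set" where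
  "tame_autos m \<delta> = generate (dp_AutoGroup m \<delta>) (elementary_autos m \<delta>)"

definition affine_autos :: "nat \<Rightarrow> (nat \<Rightarrow> 'k::field \<Rightarrow> 'k) \<Rightarrow> ('k dpoly \<Rightarrow> 'k dpoly) set" where
  "affine_autos m \<delta> = {\<phi> \<in> dp_auto m \<delta>.
     \<exists>a1 b1 c1 a2 b2 c2. a1 * b2 \<noteq> a2 * b1 \<and>
       auto_pair \<phi> = (Const a1 * dp_x + Const b1 * dp_y + Const c1,
                      Const a2 * dp_x + Const b2 * dp_y + Const c2)}"

definition elementary_transformation ::
    "nat \<Rightarrow> (nat \<Rightarrow> 'k::field \<Rightarrow> 'k) \<Rightarrow> 'k dpoly \<times> 'k dpoly \<Rightarrow> 'k dpoly \<times> 'k dpoly \<Rightarrow> bool" where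
  "elementary_transformation m \<delta> p q \<longleftrightarrow>
     (\<exists>\<alpha> g. \<alpha> \<noteq> 0 \<and> g \<in> diff_subalgebra m \<delta> (snd p) \<and> q = (Const \<alpha> * fst p + g, snd p)) \<or>
     (\<exists>\<alpha> g. \<alpha> \<noteq> 0 \<and> g \<in> diff_subalgebra m \<delta> (fst p) \<and> q = (fst p, Const \<alpha> * snd p + g))"

definition elementarily_reducible ::
    "nat \<Rightarrow> (nat \<Rightarrow> 'k::field \<Rightarrow> 'k) \<Rightarrow> ('k dpoly \<Rightarrow> 'k dpoly) \<Rightarrow> bool" where
  "elementarily_reducible m \<delta> \<theta> \<longleftrightarrow>
     (\<exists>\<phi>\<in>dp_auto m \<delta>. elementary_transformation m \<delta> (auto_pair \<theta>) (auto_pair \<phi>) \<and>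
        auto_deg \<phi> < auto_deg \<theta>)"

end

theory Submission
  imports Defs "HOL-Library.Multiset_Order" "HOL-Library.Product_Lexorder"
begin

text \<open>
  The argument runs as for automorphisms of the polynomial ring in two variables, and everything
  rests on one fact about degrees: if \<open>g\<close> is not constant, then every element of \<open>k{g}\<close> outside
  \<open>k + kg\<close> has degree larger than \<open>deg g\<close> (lemma \<open>deg_diff_subalgebra\<close>). Granting this, a tame
  automorphism is built from \<open>(x, y)\<close> by steps of one kind: make an affine change so that the
  first entry has degree at most that of the second, then add to the first entry an element \<open>h\<close>
  of \<open>k{g}\<close> outside \<open>k + kg\<close>, where \<open>g\<close> is the second entry (\<open>basic_pair\<close>). The degree
  fact says that \<open>h\<close> then dominates, so subtracting \<open>h\<close> lowers the degree again
  (\<open>basic_pair_reducible\<close>), also after a final affine change (\<open>affine_image_reduces\<close>).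
  The affine images of such pairs are closed under elementary transformations: a transformation
  acting on the dominant entry only alters its last summand \<open>h\<close>, and if \<open>h\<close> becomes affine in
  \<open>g\<close>, then the last step disappears (\<open>basic_pair_transform\<close>). Since composing an automorphism
  on the right with an elementary automorphism is an elementary transformation of its pair, all
  tame automorphisms are of this form.

  For the degree fact, order monomials by degree first and then by a multiset order coming from a
  ranking of the variables. If \<open>u\<close> is the leading monomial of \<open>g\<close> and \<open>t\<close> is its highest
  variable, then the leading monomial of \<open>\<theta> g\<close> is obtained from \<open>u\<close> by replacing one factor \<open>t\<close>
  by \<open>t\<^sup>\<theta>\<close> (\<open>lead_ders\<close>); here characteristic \<open>0\<close> is essential, because the coefficient is
  multiplied by an exponent. Different products of the \<open>\<theta> g\<close> therefore have different leading
  monomials, which cannot cancel, and the degree of a differential polynomial in \<open>g\<close> is the largest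
  of the degrees of its terms.
\<close>

section \<open>Derivations of the polynomial algebra\<close>

lemma poly_single_sum: "f = (\<Sum>u\<in>Poly_Mapping.keys f. Poly_Mapping.single u (Poly_Mapping.lookup f u))"
proof (rule poly_mapping_eqI)
  fix w
  have "Poly_Mapping.lookup (\<Sum>u\<in>Poly_Mapping.keys f. Poly_Mapping.single u (Poly_Mapping.lookup f u)) w
      = (\<Sum>u\<in>Poly_Mapping.keys f. if u = w then Poly_Mapping.lookup f w else 0)"
    by (simp add: lookup_sum lookup_single when_def cong: if_cong)
  then show "Poly_Mapping.lookup f w = Poly_Mapping.lookup (\<Sum>u\<in>Poly_Mapping.keys f. Poly_Mapping.single u (Poly_Mapping.lookup f u)) w"
    by (simp add: in_keys_iff)
qed

lemma poly_induct_single: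
  fixes P :: "('a \<Rightarrow>\<^sub>0 'b::comm_monoid_add) \<Rightarrow> bool"
  assumes "\<And>u c. u \<in> insert w (Poly_Mapping.keys f) \<Longrightarrow> P (Poly_Mapping.single u c)"
    and "\<And>g h. P g \<Longrightarrow> P h \<Longrightarrow> P (g + h)"
  shows "P f"
proof -
  have "P (\<Sum>u\<in>S. Poly_Mapping.single u (Poly_Mapping.lookup f u))"
    if "finite S" "S \<subseteq> Poly_Mapping.keys f" for S
    using that
  proof (induction rule: finite_induct)
    case empty
    show ?case using assms(1)[of w 0] by simp
  qed (auto intro: assms)
  from this[of "Poly_Mapping.keys f"] show ?thesis
    by (simp flip: poly_single_sum)
qed

lemma single_add_mset:
  "Poly_Mapping.single (add_mset v u) c = dp_var v * Poly_Mapping.single u c"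
  by (simp add: dp_var_def mult_single)

lemma poly_induct_var:
  assumes "\<And>c. P (Const c)"
    and "\<And>u v. u \<in> Poly_Mapping.keys f \<Longrightarrow> v \<in># u \<Longrightarrow> P (dp_var v)"
    and "\<And>g h. P g \<Longrightarrow> P h \<Longrightarrow> P (g + h)"
    and "\<And>g h. P g \<Longrightarrow> P h \<Longrightarrow> P (g * h)"
  shows "P f"
proof (rule poly_induct_single[where w = "{#}"])
  fix u and c :: 'a
  assume u: "u \<in> insert {#} (Poly_Mapping.keys f)"
  have "P (Poly_Mapping.single w c)" if "w \<subseteq># u" for w
    using that
  proof (induction w)
    case empty
    show ?case using assms(1)[of c] by (simp add: Const_def)
  next
    case (add v w)
    have "v \<in># u" using add.prems by (meson insert_subset_eq_iff)
    with u have "P (dp_var v)" by (auto intro: assms(2))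
    moreover have "P (Poly_Mapping.single w c)" using add by (meson mset_subset_eq_insertD subset_mset.less_imp_le)
    ultimately show ?case by (simp add: single_add_mset assms(4))
  qed
  then show "P (Poly_Mapping.single u c)" by simp
qed (rule assms(3))

lemma Const_0 [simp]: "Const 0 = 0"
  and Const_1 [simp]: "Const 1 = 1"
  and Const_add: "Const (a + b) = Const a + Const b"
  and Const_mult: "Const (a * b) = Const a * Const b"
  and Const_minus: "Const (- a) = - Const a"
  and Const_diff: "Const (a - b) = Const a - Const b"
  by (simp_all add: Const_def single_add mult_single single_uminus single_diff flip: single_one)

lemma lookup_Const_mult [simp]: "Poly_Mapping.lookup (Const c * f) u = c * Poly_Mapping.lookup f u"
proof (induction f rule: poly_induct_single[where w = "{#}"])
  case (1 w d)
  then show ?case by (simp add: Const_def mult_single lookup_single when_def)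
next
  case (2 g h)
  then show ?case by (simp add: algebra_simps lookup_add)
qed

text \<open>
  Requiring the derivations to commute for all indices, not only for those in \<open>{1..m}\<close>, allows
  \<open>\<theta> f\<close> to be defined as a fold over an arbitrary finite multiset \<open>\<theta>\<close>. A differential field in the
  sense of \<^const>\<open>differential_field\<close> is brought into this form by letting all other symbols act as
  zero.
\<close>

locale commuting_derivations =
  fixes \<delta> :: "nat \<Rightarrow> 'k::field_char_0 \<Rightarrow> 'k"
  assumes derivation: "derivation (\<delta> i)"
    and commute: "\<delta> i (\<delta> j a) = \<delta> j (\<delta> i a)"
begin

lemma \<delta>_add: "\<delta> i (a + b) = \<delta> i a + \<delta> i b"
  and \<delta>_mult: "\<delta> i (a * b) = \<delta> i a * b + a * \<delta> i b"
  using derivation[of i] by (auto simp: derivation_def)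

lemma \<delta>_0 [simp]: "\<delta> i 0 = 0"
  using \<delta>_add[of i 0 0] by simp

lemma \<delta>_1 [simp]: "\<delta> i 1 = 0"
  using \<delta>_mult[of i 1 1] by simp

abbreviation D :: "nat \<Rightarrow> 'k dpoly \<Rightarrow> 'k dpoly" where
  "D \<equiv> dp_deriv \<delta>"

definition leibniz :: "nat \<Rightarrow> dvar multiset \<Rightarrow> 'k \<Rightarrow> 'k dpoly" where
  "leibniz i u c = Poly_Mapping.single u (\<delta> i c)
     + (\<Sum>v\<in>#u. Poly_Mapping.single (add_mset (shift i v) (u - {#v#})) c)"

lemma leibniz_add: "leibniz i u (a + b) = leibniz i u a + leibniz i u b"
  by (simp add: leibniz_def \<delta>_add single_add sum_mset.distrib)

lemma leibniz_0 [simp]: "leibniz i u 0 = 0"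
  by (simp add: leibniz_def)

lemma D_superset:
  assumes "finite S" "Poly_Mapping.keys f \<subseteq> S"
  shows "D i f = (\<Sum>u\<in>S. leibniz i u (Poly_Mapping.lookup f u))"
  unfolding dp_deriv_def leibniz_def[symmetric]
  using assms by (intro sum.mono_neutral_left) (auto simp: in_keys_iff)

lemma D_add: "D i (f + g) = D i f + D i g"
proof -
  let ?S = "Poly_Mapping.keys f \<union> Poly_Mapping.keys g"
  have "D i h = (\<Sum>u\<in>?S. leibniz i u (Poly_Mapping.lookup h u))" if "h \<in> {f, g, f + g}" for h
    using that keys_add[of f g] by (intro D_superset) auto
  then show ?thesis by (simp add: lookup_add leibniz_add sum.distrib)
qed

lemma D_single: "D i (Poly_Mapping.single u c) = leibniz i u c"
  using D_superset[of "{u}" "Poly_Mapping.single u c" i] by simp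

lemma D_Const: "D i (Const c) = Const (\<delta> i c)"
  by (simp add: Const_def D_single leibniz_def)

lemma D_var: "D i (dp_var v) = dp_var (shift i v)"
  by (simp add: dp_var_def D_single leibniz_def)

lemma D_single_mult:
  "D i (Poly_Mapping.single u c * Poly_Mapping.single w d)
   = D i (Poly_Mapping.single u c) * Poly_Mapping.single w d
     + Poly_Mapping.single u c * D i (Poly_Mapping.single w d)"
proof -
  let ?s = "Poly_Mapping.single :: dvar multiset \<Rightarrow> 'k \<Rightarrow> 'k dpoly"
  have 1: "(\<Sum>v\<in>#u. ?s (add_mset (shift i v) (u + w - {#v#})) (c * d))
      = (\<Sum>v\<in>#u. ?s (add_mset (shift i v) (u - {#v#})) c) * ?s w d" for u w c d
    by (auto simp: sum_mset_distrib_right mult_single intro!: arg_cong[of _ _ sum_mset] image_mset_cong)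
  show ?thesis
    using 1[of u w c d] 1[of w u d c]
    by (simp add: mult_single D_single leibniz_def \<delta>_mult single_add distrib_left distrib_right
        add.commute mult.commute)
qed

lemma D_mult: "D i (f * g) = D i f * g + f * D i g"
proof (induction f rule: poly_induct_single[where w = "{#}"])
  case (1 u c)
  show ?case
  proof (induction g rule: poly_induct_single[where w = "{#}"])
    case (1 w d)
    show ?case by (rule D_single_mult)
  next
    case (2 g h)
    then show ?case by (simp add: D_add algebra_simps)
  qed
next
  case (2 f h)
  then show ?case by (simp add: D_add algebra_simps)
qed

text \<open>
  The derivations commute on constants and on variables, and the product rule propagates this to
  all polynomials.
\<close>

lemma D_commute: "D i (D j f) = D j (D i f)"
proof (induction f rule: poly_induct_var)
  case (2 u v)
  then show ?case by (simp add: D_var shift_def add_mset_commute)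
qed (simp_all add: D_Const D_add D_mult commute add_ac)

interpretation D: comp_fun_commute D
  by unfold_locales (simp add: fun_eq_iff D_commute)

definition ders :: "nat multiset \<Rightarrow> 'k dpoly \<Rightarrow> 'k dpoly" where
  "ders \<theta> f = fold_mset D f \<theta>"

lemma ders_empty [simp]: "ders {#} f = f"
  by (simp add: ders_def)

lemma ders_add_mset [simp]: "ders (add_mset i \<theta>) f = D i (ders \<theta> f)"
  by (simp add: ders_def)

section \<open>Differential substitutions\<close>

definition dsubst :: "(indet \<Rightarrow> 'k dpoly) \<Rightarrow> 'k dpoly \<Rightarrow> 'k dpoly" where
  "dsubst \<sigma> f = (\<Sum>u\<in>Poly_Mapping.keys f.
     Const (Poly_Mapping.lookup f u) * (\<Prod>v\<in>#u. ders (snd v) (\<sigma> (fst v))))"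

lemma dsubst_superset:
  assumes "finite S" "Poly_Mapping.keys f \<subseteq> S"
  shows "dsubst \<sigma> f = (\<Sum>u\<in>S. Const (Poly_Mapping.lookup f u) * (\<Prod>v\<in>#u. ders (snd v) (\<sigma> (fst v))))"
  unfolding dsubst_def
  using assms by (intro sum.mono_neutral_left) (auto simp: in_keys_iff)

lemma dsubst_add: "dsubst \<sigma> (f + g) = dsubst \<sigma> f + dsubst \<sigma> g"
proof -
  let ?S = "Poly_Mapping.keys f \<union> Poly_Mapping.keys g"
  have "dsubst \<sigma> h = (\<Sum>u\<in>?S. Const (Poly_Mapping.lookup h u) * (\<Prod>v\<in>#u. ders (snd v) (\<sigma> (fst v))))"
    if "h \<in> {f, g, f + g}" for h
    using that keys_add[of f g] by (intro dsubst_superset) auto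
  then show ?thesis by (simp add: lookup_add Const_add distrib_right sum.distrib)
qed

lemma dsubst_single:
  "dsubst \<sigma> (Poly_Mapping.single u c) = Const c * (\<Prod>v\<in>#u. ders (snd v) (\<sigma> (fst v)))"
  using dsubst_superset[of "{u}" "Poly_Mapping.single u c" \<sigma>] by simp

lemma dsubst_Const [simp]: "dsubst \<sigma> (Const c) = Const c"
  using dsubst_single[of \<sigma> "{#}" c] by (simp add: Const_def)

lemma dsubst_var: "dsubst \<sigma> (dp_var v) = ders (snd v) (\<sigma> (fst v))"
  by (simp add: dp_var_def dsubst_single)

lemma dsubst_mult: "dsubst \<sigma> (f * g) = dsubst \<sigma> f * dsubst \<sigma> g"
proof (induction f rule: poly_induct_single[where w = "{#}"])
  case (1 u c)
  show ?case
  proof (induction g rule: poly_induct_single[where w = "{#}"])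
    case (1 w d)
    show ?case by (simp add: mult_single dsubst_single Const_mult mult_ac)
  next
    case (2 g h)
    then show ?case by (simp add: dsubst_add algebra_simps)
  qed
next
  case (2 f h)
  then show ?case by (simp add: dsubst_add algebra_simps)
qed

lemma dsubst_D: "dsubst \<sigma> (D i f) = D i (dsubst \<sigma> f)"
proof (induction f rule: poly_induct_var)
  case (2 u v)
  then show ?case by (simp add: D_var dsubst_var shift_def)
qed (simp_all add: D_Const D_add D_mult dsubst_add dsubst_mult)

end

section \<open>Leading monomials\<close>

text \<open>
  With this order on \<^typ>\<open>indet\<close>, variables are compared lexicographically and their exponents \<open>\<theta>\<close>
  by the multiset order. The result is a ranking: it is compatible with derivations, and deriving a
  variable makes it larger.
\<close>

instantiation indet :: linorder
begin

definition less_eq_indet :: "indet \<Rightarrow> indet \<Rightarrow> bool" where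
  "less_eq_indet z z' \<longleftrightarrow> z = X \<or> z' = Y"

definition less_indet :: "indet \<Rightarrow> indet \<Rightarrow> bool" where
  "less_indet z z' \<longleftrightarrow> z = X \<and> z' = Y"

instance
  by standard (auto simp: less_eq_indet_def less_indet_def intro: indet.exhaust)

end

text \<open>
  Sorting key of the monomial order. For a linear order on variables, the multiset order on
  monomials compares the highest variables first; it is compatible with multiplication.
\<close>

definition mkey :: "dvar multiset \<Rightarrow> nat \<times> dvar multiset" where
  "mkey u = (mon_deg u, u)"

definition lead :: "'k::field dpoly \<Rightarrow> dvar multiset \<Rightarrow> bool" where
  "lead f u \<longleftrightarrow> u \<in> Poly_Mapping.keys f \<and> (\<forall>w\<in>Poly_Mapping.keys f. mkey w \<le> mkey u)"

lemma mkey_inject [simp]: "mkey u = mkey w \<longleftrightarrow> u = w"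
  by (auto simp: mkey_def)

lemma mon_deg_empty [simp]: "mon_deg {#} = 0"
  and mon_deg_add_mset [simp]: "mon_deg (add_mset v u) = Suc (size (snd v)) + mon_deg u"
  and mon_deg_add [simp]: "mon_deg (u + w) = mon_deg u + mon_deg w"
  by (simp_all add: mon_deg_def)

lemma mkey_less_add: "mkey u < mkey u' \<Longrightarrow> mkey w \<le> mkey w' \<Longrightarrow> mkey (u + w) < mkey (u' + w')"
  by (auto simp: mkey_def less_prod_def less_eq_prod_def intro: add_less_le_mono)

lemma mkey_less_deg: "mon_deg u < mon_deg w \<Longrightarrow> mkey u < mkey w"
  by (simp add: mkey_def less_prod_def)

lemma mkey_le_deg: "mkey u \<le> mkey w \<Longrightarrow> mon_deg u \<le> mon_deg w"
  by (auto simp: mkey_def less_eq_prod_def)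

lemma lead_exists: "f \<noteq> 0 \<Longrightarrow> \<exists>u. lead f u"
proof -
  assume "f \<noteq> 0"
  then have "Poly_Mapping.keys f \<noteq> {}" by simp
  then have "Max (mkey ` Poly_Mapping.keys f) \<in> mkey ` Poly_Mapping.keys f"
    by (intro Max_in) auto
  then obtain u where "u \<in> Poly_Mapping.keys f" "Max (mkey ` Poly_Mapping.keys f) = mkey u" by auto
  then show ?thesis unfolding lead_def by (metis Max_ge finite_imageI finite_keys image_eqI)
qed

lemma dp_deg_le: "dp_deg f \<le> n \<longleftrightarrow> (\<forall>u\<in>Poly_Mapping.keys f. mon_deg u \<le> n)"
  by (auto simp: dp_deg_def)

lemma mon_deg_le_dp_deg: "u \<in> Poly_Mapping.keys f \<Longrightarrow> mon_deg u \<le> dp_deg f"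
  using dp_deg_le by blast

lemma lead_deg: "lead f u \<Longrightarrow> dp_deg f = mon_deg u"
  by (auto simp: lead_def mon_deg_le_dp_deg dp_deg_le mkey_le_deg intro: antisym)

lemma lead_mult:
  assumes f: "lead f u" and g: "lead g w"
  shows "lead (f * g) (u + w)"
proof -
  have eq: "a = u \<and> b = w"
    if "a \<in> Poly_Mapping.keys f" "b \<in> Poly_Mapping.keys g" "mkey (u + w) \<le> mkey (a + b)" for a b
    using that f g mkey_less_add[of a u b w] mkey_less_add[of b w a u]
    by (fastforce simp: lead_def add.commute order.order_iff_strict)
  have "Poly_Mapping.lookup (f * g) (u + w)
      = (\<Sum>a\<in>Poly_Mapping.keys f. \<Sum>b\<in>Poly_Mapping.keys g.
          Poly_Mapping.lookup (Poly_Mapping.single (a + b) (Poly_Mapping.lookup f a * Poly_Mapping.lookup g b)) (u + w))"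
    by (subst poly_single_sum[of f], subst poly_single_sum[of g])
      (simp add: sum_product mult_single lookup_sum)
  also have "\<dots> = (\<Sum>a\<in>Poly_Mapping.keys f. \<Sum>b\<in>Poly_Mapping.keys g.
      if b = w then if a = u then Poly_Mapping.lookup f u * Poly_Mapping.lookup g w else 0 else 0)"
    using eq by (intro sum.cong refl) (auto simp: lookup_single when_def)
  also have "\<dots> = Poly_Mapping.lookup f u * Poly_Mapping.lookup g w"
    using f g by (simp add: lead_def)
  finally have "u + w \<in> Poly_Mapping.keys (f * g)"
    using f g by (simp add: in_keys_iff lead_def)
  moreover have "mkey k \<le> mkey (u + w)" if k: "k \<in> Poly_Mapping.keys (f * g)" for k
  proof -
    obtain a b where "a \<in> Poly_Mapping.keys f" "b \<in> Poly_Mapping.keys g" "k = a + b"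
      using k keys_mult[of f g] by blast
    with eq[of a b] show ?thesis by force
  qed
  ultimately show ?thesis by (simp add: lead_def)
qed

lemma lead_Const: "c \<noteq> 0 \<Longrightarrow> lead (Const c) {#}"
  by (simp add: lead_def Const_def)

lemma lead_prod_mset:
  "(\<And>v. v \<in># u \<Longrightarrow> lead (F v) (e v)) \<Longrightarrow> lead (\<Prod>v\<in>#u. F v) (\<Sum>v\<in>#u. e v)"
proof (induction u)
  case empty
  show ?case using lead_Const[of 1] by simp
qed (simp add: lead_mult)

text \<open>
  The largest of the pairwise different leading monomials occurs in only one summand, so it
  survives in the sum.
\<close>

lemma lead_sum_deg:
  assumes "finite S" and lead: "\<And>j. j \<in> S \<Longrightarrow> lead (F j) (e j)" and inj: "inj_on e S"
    and "j \<in> S"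
  shows "mon_deg (e j) \<le> dp_deg (\<Sum>j\<in>S. F j)"
proof -
  have "Max ((mkey \<circ> e) ` S) \<in> (mkey \<circ> e) ` S"
    using assms by (intro Max_in) auto
  then obtain l where l: "l \<in> S" "Max ((mkey \<circ> e) ` S) = mkey (e l)" by auto
  have max: "mkey (e i) \<le> mkey (e l)" if "i \<in> S" for i
    using that assms(1) by (auto simp flip: l(2))
  have "Poly_Mapping.lookup (F i) (e l) = 0" if "i \<in> S" "i \<noteq> l" for i
  proof (rule ccontr)
    assume "Poly_Mapping.lookup (F i) (e l) \<noteq> 0"
    then have "mkey (e l) \<le> mkey (e i)" using lead[OF \<open>i \<in> S\<close>] by (simp add: lead_def in_keys_iff)
    with max[OF \<open>i \<in> S\<close>] have "e l = e i" by (metis antisym mkey_inject)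
    with inj that l(1) show False by (auto dest: inj_onD)
  qed
  then have "Poly_Mapping.lookup (\<Sum>j\<in>S. F j) (e l) = (\<Sum>j\<in>S. if j = l then Poly_Mapping.lookup (F l) (e l) else 0)"
    unfolding lookup_sum by (intro sum.cong) auto
  also have "\<dots> \<noteq> 0"
    using lead[OF l(1)] l(1) assms(1) by (simp add: lead_def in_keys_iff)
  finally have "mon_deg (e l) \<le> dp_deg (\<Sum>j\<in>S. F j)"
    by (intro mon_deg_le_dp_deg) (simp add: in_keys_iff)
  with mkey_le_deg[OF max[OF \<open>j \<in> S\<close>]] show ?thesis by simp
qed

lemma lookup_sum_mset:
  "Poly_Mapping.lookup (\<Sum>v\<in>#u. F v) k = (\<Sum>v\<in>#u. Poly_Mapping.lookup (F v) k)"
  by (induction u) (simp_all add: lookup_add)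

lemma less_shift: "v \<le> t \<Longrightarrow> v < shift i t"
proof -
  have "t < shift i t"
    by (cases t) (simp add: shift_def less_prod_def)
  then show "v \<le> t \<Longrightarrow> v < shift i t" by simp
qed

lemma shift_mono: "v < t \<Longrightarrow> shift i v < shift i t"
  by (cases v; cases t) (auto simp: shift_def less_prod_def)

lemma mon_deg_shift: "v \<in># w \<Longrightarrow> mon_deg (add_mset (shift i v) (w - {#v#})) = Suc (mon_deg w)"
  by (auto simp: shift_def dest!: multi_member_split)

text \<open>
  The reason that differentiation acts on leading monomials: among all the monomials that the
  product rule creates from \<open>u\<close> and monomials below it, the largest one comes from deriving the
  highest variable \<open>t\<close> of \<open>u\<close>. Monomials of lower degree than \<open>u\<close> cannot compete. In the others, if
  a variable \<open>v\<close> lower than \<open>t\<close> is derived, then all variables of the outcome are smaller than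
  \<open>shift i t\<close>; if \<open>t\<close> itself is derived in a monomial smaller than \<open>u\<close>, then the comparison of
  the remaining factors decides.
\<close>

lemma mkey_shift:
  assumes t: "t \<in># u" "\<forall>v\<in>#u. v \<le> t"
    and w: "mkey w \<le> mkey u" "v \<in># w" "(w, v) \<noteq> (u, t)"
  shows "mkey (add_mset (shift i v) (w - {#v#})) < mkey (add_mset (shift i t) (u - {#t#}))"
proof (cases "mon_deg w < mon_deg u")
  case True
  then show ?thesis by (intro mkey_less_deg) (simp add: mon_deg_shift t w del: mon_deg_add_mset)
next
  case False
  with w(1) have deg: "mon_deg w = mon_deg u" and le: "w \<le> u"
    by (auto simp: mkey_def less_eq_prod_def)
  have w_le: "x \<le> t" if "x \<in># w" for x
  proof (rule ccontr)
    assume "\<not> x \<le> t"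
    with t(2) have "\<forall>y\<in>#u. y < x" by (meson le_less_trans not_le)
    with that have "u < w" by (intro ex_gt_imp_less_multiset exI[of _ x] conjI) simp_all
    with le show False by simp
  qed
  have "add_mset (shift i v) (w - {#v#}) < add_mset (shift i t) (u - {#t#})"
  proof (cases "v = t")
    case True
    with w le have "w < u" by auto
    then have "(w - {#t#}) + {#t#} < (u - {#t#}) + {#t#}"
      using w t True by simp
    then have "w - {#t#} < u - {#t#}" by (simp only: add_less_cancel_right)
    then have "(w - {#t#}) + {#shift i t#} < (u - {#t#}) + {#shift i t#}"
      by (simp only: add_less_cancel_right)
    with True show ?thesis by simp
  next
    case False
    with w_le[OF w(2)] have "v < t" by order
    then have "\<forall>x\<in>#add_mset (shift i v) (w - {#v#}). x < shift i t"
      by (auto simp: shift_mono intro!: less_shift w_le dest: in_diffD)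
    then show ?thesis by (intro ex_gt_imp_less_multiset exI[of _ "shift i t"]) (simp del: split_paired_All)
  qed
  with deg show ?thesis by (simp add: mkey_def less_prod_def mon_deg_shift t w del: mon_deg_add_mset)
qed

context commuting_derivations
begin

text \<open>
  The new leading coefficient is the old one times the multiplicity of \<open>t\<close> in \<open>u\<close>, which does not
  vanish in characteristic \<open>0\<close>.
\<close>

lemma lead_D:
  assumes f: "lead f u" and t: "t \<in># u" "\<forall>v\<in>#u. v \<le> t"
  shows "lead (D i f) (add_mset (shift i t) (u - {#t#}))" (is "lead _ ?s")
proof -
  let ?c = "Poly_Mapping.lookup f"
  have lookup: "Poly_Mapping.lookup (D i f) k = (\<Sum>w\<in>Poly_Mapping.keys f.
      (\<delta> i (?c w) when w = k) + (\<Sum>v\<in>#w. ?c w when add_mset (shift i v) (w - {#v#}) = k))" for k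
    by (simp add: dp_deriv_def lookup_sum lookup_add lookup_sum_mset lookup_single)
  have u: "u \<in> Poly_Mapping.keys f" and le: "mkey w \<le> mkey u" if "w \<in> Poly_Mapping.keys f" for w
    using f that by (auto simp: lead_def)
  have less: "mkey (add_mset (shift i v) (w - {#v#})) < mkey ?s"
    if "w \<in> Poly_Mapping.keys f" "v \<in># w" "(w, v) \<noteq> (u, t)" for w v
    using mkey_shift[OF t le] that by blast
  have less0: "mkey w < mkey ?s" if "w \<in> Poly_Mapping.keys f" for w
  proof -
    have "mkey u < mkey ?s" by (rule mkey_less_deg) (simp add: mon_deg_shift t del: mon_deg_add_mset)
    with le[OF that] show ?thesis by simp
  qed
  have "Poly_Mapping.lookup (D i f) ?s
      = (\<Sum>w\<in>Poly_Mapping.keys f. if w = u then \<Sum>v\<in>#u. if v = t then ?c u else 0 else 0)"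
    unfolding lookup
  proof (rule sum.cong[OF refl], goal_cases)
    case (1 w)
    have eq: "w = u \<and> v = t" if "v \<in># w" "add_mset (shift i v) (w - {#v#}) = ?s" for v
      using less[OF 1 that(1)] that(2) by (metis less_irrefl prod.inject)
    have "(\<Sum>v\<in>#w. ?c w when add_mset (shift i v) (w - {#v#}) = ?s)
        = (\<Sum>v\<in>#w. if w = u \<and> v = t then ?c u else 0)"
      by (intro arg_cong[of _ _ sum_mset] image_mset_cong) (use eq in \<open>auto simp: when_def\<close>)
    moreover have "w \<noteq> ?s" using less0[OF 1] by auto
    ultimately show ?case by (auto simp: when_def)
  qed
  also have "\<dots> = ?c u * of_nat (count u t)"
    using f by (simp add: lead_def sum_mset_delta)
  also have "\<dots> \<noteq> 0"
    using f t by (simp add: lead_def in_keys_iff)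
  finally have "?s \<in> Poly_Mapping.keys (D i f)" by (simp add: in_keys_iff)
  moreover have "mkey k \<le> mkey ?s" if "k \<in> Poly_Mapping.keys (D i f)" for k
  proof (rule ccontr)
    assume k: "\<not> mkey k \<le> mkey ?s"
    have "add_mset (shift i v) (w - {#v#}) \<noteq> k" if "w \<in> Poly_Mapping.keys f" "v \<in># w" for w v
      using k less[OF that] by (cases "(w, v) = (u, t)") auto
    moreover have "w \<noteq> k" if "w \<in> Poly_Mapping.keys f" for w
      using k less0[OF that] by auto
    ultimately have "Poly_Mapping.lookup (D i f) k = 0"
      unfolding lookup by (intro sum.neutral) (auto simp: when_def cong: image_mset_cong)
    with that show False by (simp add: in_keys_iff)
  qed
  ultimately show ?thesis by (simp add: lead_def)
qed

lemma lead_ders: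
  assumes "lead f u" "t \<in># u" "\<forall>v\<in>#u. v \<le> t"
  shows "lead (ders \<theta> f) (add_mset (fst t, \<theta> + snd t) (u - {#t#}))"
proof (induction \<theta>)
  case empty
  show ?case using assms by simp
next
  case (add i \<theta>)
  let ?t = "(fst t, \<theta> + snd t)"
  have "t \<le> ?t" by (cases t) (auto simp: less_eq_prod_def)
  with assms have "v \<le> ?t" if "v \<in># add_mset ?t (u - {#t#})" for v
    using that by (auto dest: in_diffD intro: order_trans)
  then have "lead (D i (ders \<theta> f)) (add_mset (shift i ?t) (add_mset ?t (u - {#t#}) - {#?t#}))"
    by (intro lead_D add) auto
  then show ?case by (simp add: shift_def)
qed

end

section \<open>Differential homomorphisms and subalgebras\<close>

definition diff_hom :: "nat \<Rightarrow> (nat \<Rightarrow> 'k::field \<Rightarrow> 'k) \<Rightarrow> ('k dpoly \<Rightarrow> 'k dpoly) \<Rightarrow> bool" where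
  "diff_hom m \<delta> \<psi> \<longleftrightarrow>
     (\<forall>f\<in>dp_algebra m. \<forall>g\<in>dp_algebra m. \<psi> (f + g) = \<psi> f + \<psi> g) \<and>
     (\<forall>f\<in>dp_algebra m. \<forall>g\<in>dp_algebra m. \<psi> (f * g) = \<psi> f * \<psi> g) \<and>
     (\<forall>c. \<psi> (Const c) = Const c) \<and>
     (\<forall>i\<in>{1..m}. \<forall>f\<in>dp_algebra m. \<psi> (dp_deriv \<delta> i f) = dp_deriv \<delta> i (\<psi> f))"

lemma dp_auto_iff: "\<phi> \<in> dp_auto m \<delta> \<longleftrightarrow> \<phi> \<in> Bij (dp_algebra m) \<and> diff_hom m \<delta> \<phi>"
  by (simp add: dp_auto_def diff_hom_def)

lemma diff_polys_iff:
  "f \<in> diff_polys m Z \<longleftrightarrow>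
     (\<forall>u\<in>Poly_Mapping.keys f. \<forall>v\<in>#u. fst v \<in> Z \<and> set_mset (snd v) \<subseteq> {1..m})"
  by (simp only: diff_polys_def case_prod_unfold mem_Collect_eq)

lemma diff_polys_Const [simp]: "Const c \<in> diff_polys m Z"
  by (simp add: diff_polys_iff Const_def)

lemma diff_polys_var: "dp_var v \<in> diff_polys m Z \<longleftrightarrow> fst v \<in> Z \<and> set_mset (snd v) \<subseteq> {1..m}"
  by (auto simp: diff_polys_iff dp_var_def)

lemma diff_polys_add: "f \<in> diff_polys m Z \<Longrightarrow> g \<in> diff_polys m Z \<Longrightarrow> f + g \<in> diff_polys m Z"
  using keys_add[of f g] unfolding diff_polys_iff by blast

lemma diff_polys_mult: "f \<in> diff_polys m Z \<Longrightarrow> g \<in> diff_polys m Z \<Longrightarrow> f * g \<in> diff_polys m Z"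
  using keys_mult[of f g] unfolding diff_polys_iff by fastforce

lemma diff_polys_mono: "Z \<subseteq> Z' \<Longrightarrow> diff_polys m Z \<subseteq> diff_polys m Z'"
  by (auto simp: diff_polys_iff subset_iff)

lemma diff_polys_uminus: "f \<in> diff_polys m Z \<Longrightarrow> - f \<in> diff_polys m Z"
  by (simp add: diff_polys_iff in_keys_iff)

context commuting_derivations
begin

lemma diff_polys_D:
  assumes "f \<in> diff_polys m Z" "i \<in> {1..m}"
  shows "D i f \<in> diff_polys m Z"
proof -
  have "f \<in> diff_polys m Z \<and> D i f \<in> diff_polys m Z"
  proof (induction f rule: poly_induct_var)
    case (2 u v)
    with assms have "fst v \<in> Z" "set_mset (snd v) \<subseteq> {1..m}" by (auto simp: diff_polys_iff)
    with assms(2) show ?case by (simp add: D_var diff_polys_var shift_def)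
  qed (simp_all add: D_Const D_add D_mult diff_polys_add diff_polys_mult)
  then show ?thesis ..
qed

lemma diff_subalgebra_subset:
  assumes "g \<in> diff_polys m Z"
  shows "diff_subalgebra m \<delta> g \<subseteq> diff_polys m Z"
proof
  fix h assume "h \<in> diff_subalgebra m \<delta> g"
  then show "h \<in> diff_polys m Z"
    by induction (auto simp: assms diff_polys_add diff_polys_mult intro: diff_polys_D)
qed

lemma diff_polys_induct:
  assumes f: "f \<in> diff_polys m Z"
    and "\<And>c. P (Const c)"
    and "\<And>z. z \<in> Z \<Longrightarrow> P (dp_var (z, {#}))"
    and "\<And>g h. g \<in> diff_polys m Z \<Longrightarrow> h \<in> diff_polys m Z \<Longrightarrow> P g \<Longrightarrow> P h \<Longrightarrow> P (g + h)"
    and "\<And>g h. g \<in> diff_polys m Z \<Longrightarrow> h \<in> diff_polys m Z \<Longrightarrow> P g \<Longrightarrow> P h \<Longrightarrow> P (g * h)"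
    and "\<And>g i. g \<in> diff_polys m Z \<Longrightarrow> i \<in> {1..m} \<Longrightarrow> P g \<Longrightarrow> P (D i g)"
  shows "P f"
proof -
  have var: "P (dp_var (z, \<theta>))" if "z \<in> Z" "set_mset \<theta> \<subseteq> {1..m}" for z \<theta>
    using that(2)
  proof (induction \<theta>)
    case empty
    show ?case using assms(3) that(1) .
  next
    case (add i \<theta>)
    then have "P (D i (dp_var (z, \<theta>)))" by (intro assms(6)) (auto simp: diff_polys_var that(1))
    then show ?case by (simp add: D_var shift_def)
  qed
  have "f \<in> diff_polys m Z \<and> P f"
  proof (induction f rule: poly_induct_var)
    case (2 u v)
    with f have "fst v \<in> Z" "set_mset (snd v) \<subseteq> {1..m}" by (auto simp: diff_polys_iff)
    with var show ?case by (cases v) (auto simp: diff_polys_var)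
  qed (auto simp: assms(2) intro: assms diff_polys_add diff_polys_mult)
  then show ?thesis ..
qed

lemma diff_subalgebra_var: "diff_subalgebra m \<delta> (dp_var (z, {#})) = diff_polys m {z}"
proof
  show "diff_subalgebra m \<delta> (dp_var (z, {#})) \<subseteq> diff_polys m {z}"
    by (rule diff_subalgebra_subset) (simp add: diff_polys_var)
  show "diff_polys m {z} \<subseteq> diff_subalgebra m \<delta> (dp_var (z, {#}))"
  proof
    fix f :: "'k dpoly" assume "f \<in> diff_polys m {z}"
    then show "f \<in> diff_subalgebra m \<delta> (dp_var (z, {#}))"
      by (rule diff_polys_induct[where P = "\<lambda>f. f \<in> diff_subalgebra m \<delta> (dp_var (z, {#}))"])
        (auto intro: diff_subalgebra.intros)
  qed
qed

lemma diff_hom_image: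
  assumes \<psi>: "diff_hom m \<delta> \<psi>" and g: "g \<in> dp_algebra m"
  shows "\<psi> ` diff_subalgebra m \<delta> g = diff_subalgebra m \<delta> (\<psi> g)"
proof (intro subset_antisym subsetI)
  have sub: "f \<in> diff_subalgebra m \<delta> g \<Longrightarrow> f \<in> dp_algebra m" for f
    using diff_subalgebra_subset[OF g] by blast
  fix h
  {
    assume "h \<in> \<psi> ` diff_subalgebra m \<delta> g"
    then obtain f where "f \<in> diff_subalgebra m \<delta> g" "h = \<psi> f" by blast
    then show "h \<in> diff_subalgebra m \<delta> (\<psi> g)"
      by (induction arbitrary: h) (use \<psi> sub in \<open>auto simp: diff_hom_def intro: diff_subalgebra.intros\<close>)
  next
    assume "h \<in> diff_subalgebra m \<delta> (\<psi> g)"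
    then have "\<exists>f\<in>diff_subalgebra m \<delta> g. h = \<psi> f"
    proof induction
      case gen
      show ?case by (blast intro: diff_subalgebra.intros)
    next
      case (const c)
      show ?case using \<psi> by (intro bexI[of _ "Const c"]) (auto simp: diff_hom_def intro: diff_subalgebra.intros)
    next
      case (add h1 h2)
      then obtain f1 f2 where "f1 \<in> diff_subalgebra m \<delta> g" "h1 = \<psi> f1" "f2 \<in> diff_subalgebra m \<delta> g" "h2 = \<psi> f2"
        by blast
      then show ?case using \<psi> sub
        by (intro bexI[of _ "f1 + f2"]) (auto simp: diff_hom_def intro: diff_subalgebra.intros)
    next
      case (mult h1 h2)
      then obtain f1 f2 where "f1 \<in> diff_subalgebra m \<delta> g" "h1 = \<psi> f1" "f2 \<in> diff_subalgebra m \<delta> g" "h2 = \<psi> f2"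
        by blast
      then show ?case using \<psi> sub
        by (intro bexI[of _ "f1 * f2"]) (auto simp: diff_hom_def intro: diff_subalgebra.intros)
    next
      case (deriv h i)
      then obtain f where "f \<in> diff_subalgebra m \<delta> g" "h = \<psi> f" by blast
      then show ?case using \<psi> sub deriv(2)
        by (intro bexI[of _ "D i f"]) (auto simp: diff_hom_def intro: diff_subalgebra.intros)
    qed
    then show "h \<in> \<psi> ` diff_subalgebra m \<delta> g" by blast
  }
qed

lemma diff_hom_dsubst: "diff_hom m \<delta> (dsubst \<sigma>)"
  by (simp add: diff_hom_def dsubst_add dsubst_mult dsubst_D)

section \<open>Degrees in a one-generated differential subalgebra\<close>

text \<open>
  Write \<open>h\<close> as a differential polynomial \<open>P\<close> evaluated at \<open>g\<close>. The leading monomials of the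
  terms of \<open>P\<close> after evaluation are pairwise different, so each of them has degree at most
  \<open>deg h\<close>. A product of derivatives \<open>\<theta>\<^sub>1 g, \<dots>, \<theta>\<^sub>r g\<close> has degree \<open>r deg g + \<Sum>\<bar>\<theta>\<^sub>i\<bar>\<close>, so only the terms
  \<open>1\<close> and \<open>g\<close> can stay within \<open>deg g\<close>.
\<close>

lemma deg_diff_subalgebra:
  assumes h: "h \<in> diff_subalgebra m \<delta> g" and g: "dp_deg g > 0" and le: "dp_deg h \<le> dp_deg g"
  obtains a b where "h = Const a * g + Const b"
proof -
  have "g \<noteq> 0" using g by (auto simp: dp_deg_def)
  then obtain u where u: "lead g u" using lead_exists by blast
  with g have deg_u: "mon_deg u = dp_deg g" "u \<noteq> {#}" by (auto simp: lead_deg)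
  define t where "t = Max_mset u"
  have t: "t \<in># u" "\<forall>v\<in>#u. v \<le> t" using deg_u by (auto simp: t_def)
  have "dp_y \<in> dp_algebra m" by (simp add: dp_y_def diff_polys_var)
  from h diff_hom_image[OF diff_hom_dsubst this, of "\<lambda>_. g"]
  obtain P where P: "P \<in> diff_polys m {Y}" "h = dsubst (\<lambda>_. g) P"
    by (auto simp: dp_y_def dsubst_var simp flip: diff_subalgebra_var)
  define e where "e w = (\<Sum>v\<in>#w. add_mset (fst t, snd v + snd t) (u - {#t#}))" for w :: "dvar multiset"
  have lead: "lead (Const (Poly_Mapping.lookup P w) * (\<Prod>v\<in>#w. ders (snd v) g)) (e w)"
    if "w \<in> Poly_Mapping.keys P" for w
  proof -
    have "lead (\<Prod>v\<in>#w. ders (snd v) g) (e w)"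
      unfolding e_def by (intro lead_prod_mset lead_ders u t)
    moreover have "lead (Const (Poly_Mapping.lookup P w)) {#}"
      using that by (simp add: lead_Const in_keys_iff)
    ultimately show ?thesis using lead_mult by fastforce
  qed
  have e: "e w = image_mset (\<lambda>v. (fst t, snd v + snd t)) w + repeat_mset (size w) (u - {#t#})" for w
    by (induction w) (simp_all add: e_def)
  have size: "size u = Suc (size (u - {#t#}))"
    using t(1) by (metis insert_DiffM size_add_mset)
  \<comment> \<open>The size of \<open>e w\<close> determines the number of factors, hence the part \<open>(u - t)\<^sup>r\<close> can be cancelled;
     the remaining variables \<open>t\<^sup>\<theta>\<close> reveal \<open>w\<close> because \<open>P\<close> involves only the symbol \<open>Y\<close>.\<close>
  have "inj_on e (Poly_Mapping.keys P)"
  proof (rule inj_onI)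
    fix w w' assume w: "w \<in> Poly_Mapping.keys P" "w' \<in> Poly_Mapping.keys P" "e w = e w'"
    have "size (e w) = size w * size u" for w
      by (simp add: e size)
    with w(3) size have "size w = size w'" by (metis mult_cancel2 nat.distinct(1))
    with w(3) have eq: "image_mset (\<lambda>v. (fst t, snd v + snd t)) w = image_mset (\<lambda>v. (fst t, snd v + snd t)) w'"
      by (simp add: e)
    have inv: "image_mset (\<lambda>v. (Y, snd v - snd t)) (image_mset (\<lambda>v. (fst t, snd v + snd t)) x) = x"
      if "x \<in> Poly_Mapping.keys P" for x
    proof -
      have "fst v = Y" if "v \<in># x" for v
        using P(1) \<open>x \<in> Poly_Mapping.keys P\<close> that by (simp add: diff_polys_iff)
      then have "(Y, snd v) = v" if "v \<in># x" for v
        using that by (simp add: prod_eq_iff)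
      then show ?thesis unfolding image_mset.compositionality by (intro multiset.map_ident_strong) simp
    qed
    show "w = w'" using inv[OF w(1)] inv[OF w(2)] unfolding eq by (rule trans[OF sym])
  qed
  from lead_sum_deg[OF finite_keys lead this]
  have deg_e: "mon_deg (e w) \<le> mon_deg u" if "w \<in> Poly_Mapping.keys P" for w
    using le that unfolding P(2) deg_u(1) dsubst_def by (blast intro: order_trans)
  have split: "mon_deg (e (add_mset v w)) = mon_deg u + size (snd v) + mon_deg (e w)" for v w
    using t(1) by (auto simp: e_def dest!: multi_member_split)
  have keys: "w = {#} \<or> w = {#(Y, {#})#}" if w: "w \<in> Poly_Mapping.keys P" for w
  proof (cases w)
    case (add v w')
    with deg_e[OF w] have "snd v = {#}" "mon_deg (e w') = 0" by (auto simp: split)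
    moreover have "w' = {#}"
    proof (cases w')
      case (add v' w'')
      with \<open>mon_deg (e w') = 0\<close> g deg_u(1) show ?thesis by (simp add: split)
    qed
    moreover have "fst v = Y" using P(1) w add by (auto simp: diff_polys_iff)
    ultimately show ?thesis using add by (cases v) simp
  qed simp
  then have "h = Const (Poly_Mapping.lookup P {#(Y, {#})#}) * g + Const (Poly_Mapping.lookup P {#})"
    unfolding P(2) by (subst dsubst_superset[of "{{#}, {#(Y, {#})#}}"]) auto
  then show thesis by (rule that)
qed

end

section \<open>Degrees of affine combinations\<close>

lemma dp_deg_add: "dp_deg (f + g) \<le> max (dp_deg f) (dp_deg g)"
  using keys_add[of f g] by (force simp: dp_deg_le intro: le_max_iff_disj[THEN iffD2] mon_deg_le_dp_deg)

lemma dp_deg_Const [simp]: "dp_deg (Const c) = 0"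
proof -
  have "dp_deg (Const c) \<le> 0" unfolding dp_deg_le by (simp add: Const_def)
  then show ?thesis by simp
qed

lemma dp_deg_Const_mult_le: "dp_deg (Const c * f) \<le> dp_deg f"
  unfolding dp_deg_le by (auto simp: in_keys_iff intro: mon_deg_le_dp_deg)

lemma dp_deg_Const_mult:
  assumes "c \<noteq> 0" shows "dp_deg (Const c * f) = dp_deg f"
proof (rule antisym[OF dp_deg_Const_mult_le])
  show "dp_deg f \<le> dp_deg (Const c * f)"
    using dp_deg_Const_mult_le[of "1 / c" "Const c * f"] assms
    by (simp flip: mult.assoc Const_mult)
qed

lemma dp_deg_add_eq: "dp_deg g < dp_deg f \<Longrightarrow> dp_deg (f + g) = dp_deg f"
  using dp_deg_add[of f g] dp_deg_add[of "f + g" "Const (-1) * g"] dp_deg_Const_mult[of "-1" g]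
  by (simp add: Const_minus)

lemma dp_deg_combination:
  assumes "dp_deg q < dp_deg p" "a \<noteq> 0"
  shows "dp_deg (Const a * p + Const b * q + Const c) = dp_deg p"
proof -
  have "dp_deg (Const a * p + Const b * q) = dp_deg p"
    using assms dp_deg_Const_mult[OF assms(2), of p] dp_deg_Const_mult_le[of b q]
    by (subst dp_deg_add_eq) auto
  with assms show ?thesis by (subst dp_deg_add_eq) auto
qed

lemma dp_deg_affine: "a \<noteq> 0 \<Longrightarrow> dp_deg q > 0 \<Longrightarrow> dp_deg (Const a * q + Const c) = dp_deg q"
  using dp_deg_combination[of 0 q a 0 c] by (simp add: dp_deg_def[of 0])

lemma dp_deg_affine_xy:
  assumes "a \<noteq> 0 \<or> b \<noteq> 0"
  shows "dp_deg (Const a * dp_x + Const b * dp_y + Const c) = 1" (is "dp_deg ?f = 1")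
proof (rule antisym)
  have l: "Poly_Mapping.lookup ?f u = (a when {#(X, {#})#} = u) + (b when {#(Y, {#})#} = u) + (c when {#} = u)" for u
    by (simp only: lookup_add lookup_Const_mult)
      (simp add: dp_x_def dp_y_def dp_var_def Const_def lookup_single when_def)
  show "dp_deg ?f \<le> 1"
    unfolding dp_deg_le Ball_def in_keys_iff l by (auto simp: when_def split: if_splits)
  have "{#(X, {#})#} \<in> Poly_Mapping.keys ?f \<or> {#(Y, {#})#} \<in> Poly_Mapping.keys ?f"
    using assms by (simp only: in_keys_iff l) (auto simp: when_def)
  then show "1 \<le> dp_deg ?f"
    using mon_deg_le_dp_deg[of "{#(X, {#})#}" ?f] mon_deg_le_dp_deg[of "{#(Y, {#})#}" ?f] by auto
qed

section \<open>Pairs of standard form\<close>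

definition affine_image :: "'k::field dpoly \<times> 'k dpoly \<Rightarrow> 'k dpoly \<times> 'k dpoly \<Rightarrow> bool" where
  "affine_image p q \<longleftrightarrow> (\<exists>a1 b1 c1 a2 b2 c2. a1 * b2 \<noteq> a2 * b1 \<and>
     q = (Const a1 * fst p + Const b1 * snd p + Const c1,
          Const a2 * fst p + Const b2 * snd p + Const c2))"

lemma affine_imageI:
  "a1 * b2 \<noteq> a2 * b1 \<Longrightarrow> f = Const a1 * fst p + Const b1 * snd p + Const c1 \<Longrightarrow>
   g = Const a2 * fst p + Const b2 * snd p + Const c2 \<Longrightarrow> affine_image p (f, g)"
  unfolding affine_image_def by blast

lemma affine_image_trans:
  assumes "affine_image p q" "affine_image q r"
  shows "affine_image p r"
proof -
  obtain a1 b1 c1 a2 b2 c2 where 1: "a1 * b2 \<noteq> a2 * b1"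
    "q = (Const a1 * fst p + Const b1 * snd p + Const c1, Const a2 * fst p + Const b2 * snd p + Const c2)"
    using assms(1) unfolding affine_image_def by blast
  obtain d1 e1 f1 d2 e2 f2 where 2: "d1 * e2 \<noteq> d2 * e1"
    "r = (Const d1 * fst q + Const e1 * snd q + Const f1, Const d2 * fst q + Const e2 * snd q + Const f2)"
    using assms(2) unfolding affine_image_def by blast
  have "(d1 * e2 - d2 * e1) * (a1 * b2 - a2 * b1) \<noteq> 0" using 1 2 by simp
  then have "(d1 * a1 + e1 * a2) * (d2 * b1 + e2 * b2) \<noteq> (d2 * a1 + e2 * a2) * (d1 * b1 + e1 * b2)"
    by (simp add: algebra_simps)
  then show ?thesis unfolding 2(2)
    by (rule affine_imageI[where ?c1.0 = "d1 * c1 + e1 * c2 + f1" and ?c2.0 = "d2 * c1 + e2 * c2 + f2"])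
      (simp_all add: 1(2) Const_add Const_mult algebra_simps)
qed

lemma affine_image_triangular:
  "\<alpha> \<noteq> 0 \<Longrightarrow> b \<noteq> 0 \<Longrightarrow> affine_image (f, g) (Const \<alpha> * f + Const a * g + Const c, Const b * g + Const d)"
  by (rule affine_imageI[of \<alpha> b 0 a _ _ c _ d]) auto

lemma affine_image_refl: "affine_image p p"
  using affine_image_triangular[of 1 1 "fst p" "snd p" 0 0 0] by simp

lemma affine_image_swap: "affine_image (f, g) (g, f)"
  by (rule affine_imageI[of 0 0 1 1 _ _ 0 _ 0]) auto

definition affine_span :: "'k::field dpoly \<Rightarrow> 'k dpoly set" where
  "affine_span g = {Const a * g + Const b | a b. True}"

text \<open>
  The condition \<open>h \<notin> affine_span g\<close> keeps affine changes and proper steps apart, so that each step strictly raises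
  the degree of the pair.
\<close>

inductive basic_pair :: "nat \<Rightarrow> (nat \<Rightarrow> 'k::field \<Rightarrow> 'k) \<Rightarrow> 'k dpoly \<times> 'k dpoly \<Rightarrow> bool"
  for m :: nat and \<delta> :: "nat \<Rightarrow> 'k \<Rightarrow> 'k" where
  base: "basic_pair m \<delta> (dp_x, dp_y)"
| step: "basic_pair m \<delta> p \<Longrightarrow> affine_image p (f, g) \<Longrightarrow> dp_deg f \<le> dp_deg g \<Longrightarrow>
    h \<in> diff_subalgebra m \<delta> g \<Longrightarrow> h \<notin> affine_span g \<Longrightarrow> basic_pair m \<delta> (f + h, g)"

lemma diff_subalgebra_trans:
  assumes "g \<in> diff_subalgebra m \<delta> f" "h \<in> diff_subalgebra m \<delta> g"
  shows "h \<in> diff_subalgebra m \<delta> f"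
  using assms(2) by induction (auto intro: diff_subalgebra.intros assms(1))

lemma diff_subalgebra_affine:
  "g \<in> diff_subalgebra m \<delta> f \<Longrightarrow> Const a * g + Const b \<in> diff_subalgebra m \<delta> f"
  by (intro diff_subalgebra.intros)

lemma diff_subalgebra_affine_gen:
  assumes "b \<noteq> 0" shows "g \<in> diff_subalgebra m \<delta> (Const b * g + Const c)"
proof -
  have "g = Const (1 / b) * (Const b * g + Const c) + Const (- c / b)"
    using assms by (simp add: distrib_left Const_mult[symmetric] Const_add[symmetric] add.assoc flip: mult.assoc)
  then show ?thesis by (metis diff_subalgebra_affine diff_subalgebra.gen)
qed

context commuting_derivations
begin

lemma deg_nonaffine:
  assumes "h \<in> diff_subalgebra m \<delta> g" "dp_deg g > 0" "h \<notin> affine_span g"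
  shows "dp_deg g < dp_deg h"
  using assms deg_diff_subalgebra[OF assms(1,2)] by (force simp: affine_span_def)

text \<open>
  The shape of a pair right after a proper step: the first entry dominates, and the second one can
  lower its degree.
\<close>

definition reducible_pair :: "nat \<Rightarrow> 'k dpoly \<times> 'k dpoly \<Rightarrow> bool" where
  "reducible_pair m p \<longleftrightarrow> 0 < dp_deg (snd p) \<and> dp_deg (snd p) < dp_deg (fst p) \<and>
     (\<exists>h\<in>diff_subalgebra m \<delta> (snd p). dp_deg (fst p + h) < dp_deg (fst p))"

lemma dp_deg_affine_image:
  assumes "p = (dp_x, dp_y) \<or> reducible_pair m p" "affine_image p (f, g)"
  shows "dp_deg f > 0" "dp_deg g > 0"
proof -
  have *: "dp_deg (Const a * fst p + Const b * snd p + Const c) > 0" if "a \<noteq> 0 \<or> b \<noteq> 0" for a b c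
  proof (cases "p = (dp_x, dp_y)")
    case True
    with that show ?thesis by (simp add: dp_deg_affine_xy)
  next
    case False
    with assms(1) have "0 < dp_deg (snd p)" "dp_deg (snd p) < dp_deg (fst p)"
      by (auto simp: reducible_pair_def)
    with that show ?thesis by (cases "a = 0") (auto simp: dp_deg_combination dp_deg_affine)
  qed
  then show "dp_deg f > 0" "dp_deg g > 0"
    using assms(2) unfolding affine_image_def by (metis mult_zero_left mult_zero_right prod.inject)+
qed

lemma basic_pair_reducible: "basic_pair m \<delta> p \<Longrightarrow> p = (dp_x, dp_y) \<or> reducible_pair m p"
proof (induction rule: basic_pair.induct)
  case (step p f g h)
  have g: "dp_deg g > 0" using dp_deg_affine_image step by blast
  with step have "dp_deg g < dp_deg h" by (simp add: deg_nonaffine)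
  with step have "dp_deg (f + h) = dp_deg h" by (metis add.commute dp_deg_add_eq le_less_trans)
  moreover have "Const (- 1) * h + Const 0 \<in> diff_subalgebra m \<delta> g"
    using step(4) by (rule diff_subalgebra_affine)
  ultimately have "reducible_pair m (f + h, g)"
    using step g \<open>dp_deg g < dp_deg h\<close>
    by (auto simp: reducible_pair_def Const_minus intro!: bexI[of _ "- h"])
  then show ?case ..
qed simp

text \<open>
  If \<open>h\<close> is affine in \<open>g\<close>, then nothing but an affine change has happened, and if \<open>deg f \<le> deg g\<close>,
  then \<open>h\<close> makes a new step. In the remaining case \<open>deg g < deg f\<close> the entry \<open>g\<close> has to be an
  affine function of the second entry \<open>g0\<close> of \<open>p\<close>, since any contribution of the dominant first
  entry would make \<open>deg g\<close> maximal. So \<open>h\<close> merges with the summand \<open>h0\<close> of the last step into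
  an element \<open>h'\<close> of \<open>k{g0}\<close>, and that step is either modified or, for affine \<open>h'\<close>, undone.
\<close>

lemma basic_pair_transform:
  assumes p: "basic_pair m \<delta> p" "affine_image p (f, g)" and "\<alpha> \<noteq> 0"
    and h: "h \<in> diff_subalgebra m \<delta> g"
  shows "\<exists>q. basic_pair m \<delta> q \<and> affine_image q (Const \<alpha> * f + h, g)"
proof -
  have scale: "affine_image p (Const \<alpha> * f + Const a * g + Const b, g)"
    if "affine_image p (f, g)" "\<alpha> \<noteq> 0" for p :: "'k dpoly \<times> 'k dpoly" and \<alpha> a b f g
    using affine_image_trans[OF that(1) affine_image_triangular[of \<alpha> 1 f g a b 0]] that(2) by simp
  consider "h \<in> affine_span g" | "h \<notin> affine_span g" "dp_deg f \<le> dp_deg g" | "dp_deg g < dp_deg f"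
    by linarith
  then show ?thesis
  proof cases
    case 1
    then obtain a b where "h = Const a * g + Const b" by (auto simp: affine_span_def)
    with scale[OF p(2) \<open>\<alpha> \<noteq> 0\<close>, of a b] p(1) show ?thesis
      by (intro exI[of _ p]) (simp add: add.assoc)
  next
    case 2
    then have "basic_pair m \<delta> (Const \<alpha> * f + h, g)"
      using scale[OF p(2) \<open>\<alpha> \<noteq> 0\<close>, of 0 0] p(1) h
      by (intro basic_pair.step[of m \<delta> p]) (auto simp: dp_deg_Const_mult[OF \<open>\<alpha> \<noteq> 0\<close>])
    then show ?thesis using affine_image_refl by blast
  next
    case 3
    obtain a1 b1 c1 a2 b2 c2 where det: "a1 * b2 \<noteq> a2 * b1"
      and fg: "f = Const a1 * fst p + Const b1 * snd p + Const c1"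
        "g = Const a2 * fst p + Const b2 * snd p + Const c2"
      using p(2) unfolding affine_image_def by blast
    have "p \<noteq> (dp_x, dp_y)"
    proof
      assume "p = (dp_x, dp_y)"
      then have "dp_deg f = 1" "dp_deg g = 1"
        using det unfolding fg by (auto intro!: dp_deg_affine_xy[unfolded One_nat_def])
      with 3 show False by simp
    qed
    with p(1) basic_pair_reducible have red: "reducible_pair m p" by blast
    then have deg: "dp_deg (snd p) < dp_deg (fst p)" by (simp add: reducible_pair_def)
    have "a2 = 0"
    proof (rule ccontr)
      assume "a2 \<noteq> 0"
      with deg have "dp_deg g = dp_deg (fst p)" unfolding fg by (rule dp_deg_combination)
      moreover have "dp_deg f \<le> dp_deg (fst p)"
      proof (cases "a1 = 0")
        case True
        with det have "b1 \<noteq> 0" by auto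
        with True deg red show ?thesis by (simp add: fg dp_deg_affine reducible_pair_def)
      next
        case False
        with deg show ?thesis by (simp add: fg dp_deg_combination)
      qed
      ultimately show False using 3 by simp
    qed
    with det have nz: "a1 \<noteq> 0" "b2 \<noteq> 0" by auto
    from p(1) show ?thesis
    proof cases
      case base
      with \<open>p \<noteq> _\<close> show ?thesis by simp
    next
      case (step p0 f0 g0 h0)
      define h' where "h' = Const (\<alpha> * a1) * h0 + Const (\<alpha> * b1) * g0 + Const (\<alpha> * c1) + h"
      have g: "g = Const b2 * g0 + Const c2" using step(1) \<open>a2 = 0\<close> by (simp add: fg)
      have f: "Const \<alpha> * f + h = Const (\<alpha> * a1) * f0 + h'"
        using step(1) by (simp add: fg h'_def Const_mult algebra_simps)
      have "g \<in> diff_subalgebra m \<delta> g0"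
        unfolding g by (intro diff_subalgebra.intros)
      then have h': "h' \<in> diff_subalgebra m \<delta> g0"
        unfolding h'_def using step h by (intro diff_subalgebra.intros) (auto intro: diff_subalgebra_trans)
      have "\<alpha> * a1 \<noteq> 0" using nz \<open>\<alpha> \<noteq> 0\<close> by simp
      have fin: "affine_image (Const (\<alpha> * a1) * f0 + h', g0) (Const \<alpha> * f + h, g)"
        unfolding f g using affine_image_triangular[of 1 b2 "Const (\<alpha> * a1) * f0 + h'" g0 0 0 c2] nz by simp
      show ?thesis
      proof (cases "h' \<in> affine_span g0")
        case True
        then obtain a b where "h' = Const a * g0 + Const b" by (auto simp: affine_span_def)
        with scale[OF step(3) \<open>\<alpha> * a1 \<noteq> 0\<close>, of a b]
        have "affine_image p0 (Const (\<alpha> * a1) * f0 + h', g0)" by (simp add: add.assoc)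
        with step(2) fin show ?thesis using affine_image_trans by blast
      next
        case False
        have "basic_pair m \<delta> (Const (\<alpha> * a1) * f0 + h', g0)"
          using step(2) scale[OF step(3) \<open>\<alpha> * a1 \<noteq> 0\<close>, of 0 0] step(4) h' False
          by (intro basic_pair.step[of m \<delta> p0]) (simp_all add: dp_deg_Const_mult[OF \<open>\<alpha> * a1 \<noteq> 0\<close>])
        with fin show ?thesis by blast
      qed
    qed
  qed
qed

text \<open>
  If both \<open>f\<close> and \<open>g\<close> involve the dominant entry \<open>p1\<close>, then it cancels in a linear combination of
  \<open>f\<close> and \<open>g\<close>. Otherwise one of them generates the same subalgebra as the other entry \<open>p2\<close>, which
  can reduce \<open>p1\<close>.
\<close>

lemma affine_image_reduces:
  assumes p: "reducible_pair m p" and pq: "affine_image p (f, g)"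
  shows "(\<exists>h\<in>diff_subalgebra m \<delta> g. dp_deg (f + h) < dp_deg f) \<or>
    (\<exists>h\<in>diff_subalgebra m \<delta> f. dp_deg (g + h) < dp_deg g)"
proof -
  obtain p1 p2 where p_eq: "p = (p1, p2)" by (cases p)
  from p obtain r where deg: "0 < dp_deg p2" "dp_deg p2 < dp_deg p1"
    and r: "r \<in> diff_subalgebra m \<delta> p2" "dp_deg (p1 + r) < dp_deg p1"
    by (auto simp: reducible_pair_def p_eq)
  have triangular: "\<exists>h\<in>diff_subalgebra m \<delta> (Const b' * p2 + Const c').
      dp_deg (Const a * p1 + Const b * p2 + Const c + h) < dp_deg (Const a * p1 + Const b * p2 + Const c)"
    if "a \<noteq> 0" "b' \<noteq> 0" for a b c b' c'
  proof
    have "Const a * r + Const (- b) * p2 + Const (- c) \<in> diff_subalgebra m \<delta> p2"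
      using r(1) by (intro diff_subalgebra.intros)
    then show "Const a * r + Const (- b) * p2 + Const (- c) \<in> diff_subalgebra m \<delta> (Const b' * p2 + Const c')"
      by (rule diff_subalgebra_trans[OF diff_subalgebra_affine_gen[OF that(2)]])
    have "Const a * p1 + Const b * p2 + Const c + (Const a * r + Const (- b) * p2 + Const (- c))
        = Const a * (p1 + r)"
      by (simp add: Const_minus algebra_simps)
    then show "dp_deg (Const a * p1 + Const b * p2 + Const c + (Const a * r + Const (- b) * p2 + Const (- c)))
        < dp_deg (Const a * p1 + Const b * p2 + Const c)"
      using r(2) deg that by (simp add: dp_deg_Const_mult dp_deg_combination)
  qed
  obtain a1 b1 c1 a2 b2 c2 where det: "a1 * b2 \<noteq> a2 * b1"
    and fg: "f = Const a1 * p1 + Const b1 * p2 + Const c1" "g = Const a2 * p1 + Const b2 * p2 + Const c2"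
    using pq unfolding affine_image_def p_eq by auto
  consider "a2 = 0" | "a1 = 0" | "a1 \<noteq> 0" "a2 \<noteq> 0" by blast
  then show ?thesis
  proof cases
    case 1
    with det triangular[of a1 b2 c2 b1 c1] show ?thesis by (simp add: fg)
  next
    case 2
    with det triangular[of a2 b1 c1 b2 c2] show ?thesis by (simp add: fg)
  next
    case 3
    define s where "s = a1 / a2"
    have s: "a1 = s * a2" using 3 by (simp add: s_def)
    let ?h = "Const (- s) * g"
    have "f + ?h = Const (b1 + - (s * b2)) * p2 + Const (c1 + - (s * c2))"
      by (simp add: fg s Const_minus Const_diff Const_add Const_mult algebra_simps)
    then have "dp_deg (f + ?h) \<le> dp_deg p2"
      using dp_deg_add[of "Const (b1 + - (s * b2)) * p2" "Const (c1 + - (s * c2))"]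
        dp_deg_Const_mult_le[of "b1 + - (s * b2)" p2] by simp
    also have "\<dots> < dp_deg f" using deg 3 by (simp add: fg dp_deg_combination)
    finally show ?thesis by (blast intro: diff_subalgebra.intros)
  qed
qed

end

section \<open>The group of automorphisms\<close>

lemma dp_algebra_UNIV: "dp_algebra m = diff_polys m UNIV"
proof -
  have "{X, Y} = UNIV" using indet.exhaust by auto
  then show ?thesis by simp
qed

lemma diff_polys_subset_algebra: "f \<in> diff_polys m Z \<Longrightarrow> f \<in> dp_algebra m"
  using diff_polys_mono[of Z UNIV m] by (auto simp: dp_algebra_UNIV)

lemma dp_var_algebra [simp]: "dp_var (z, {#}) \<in> dp_algebra m"
  by (simp add: dp_algebra_UNIV diff_polys_var)

lemma dp_auto_mem: "\<phi> \<in> dp_auto m \<delta> \<Longrightarrow> f \<in> dp_algebra m \<Longrightarrow> \<phi> f \<in> dp_algebra m"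
  using Bij_imp_funcset[of \<phi> "dp_algebra m"] by (auto simp: dp_auto_iff)

lemma diff_homD:
  assumes "diff_hom m \<delta> \<psi>"
  shows "f \<in> dp_algebra m \<Longrightarrow> g \<in> dp_algebra m \<Longrightarrow> \<psi> (f + g) = \<psi> f + \<psi> g"
    and "f \<in> dp_algebra m \<Longrightarrow> g \<in> dp_algebra m \<Longrightarrow> \<psi> (f * g) = \<psi> f * \<psi> g"
    and "\<psi> (Const c) = Const c"
    and "i \<in> {1..m} \<Longrightarrow> f \<in> dp_algebra m \<Longrightarrow> \<psi> (dp_deriv \<delta> i f) = dp_deriv \<delta> i (\<psi> f)"
  using assms by (auto simp: diff_hom_def)

context commuting_derivations
begin

lemma diff_hom_eqI:
  assumes "diff_hom m \<delta> \<psi>" "diff_hom m \<delta> \<chi>" "f \<in> diff_polys m Z"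
    and "\<And>z. z \<in> Z \<Longrightarrow> \<psi> (dp_var (z, {#})) = \<chi> (dp_var (z, {#}))"
  shows "\<psi> f = \<chi> f"
  using assms(3)
  by (rule diff_polys_induct)
    (auto simp: assms(4) diff_homD[OF assms(1)] diff_homD[OF assms(2)] diff_polys_subset_algebra)

lemma diff_hom_compose:
  assumes "diff_hom m \<delta> \<psi>" "diff_hom m \<delta> \<chi>" "\<And>f. f \<in> dp_algebra m \<Longrightarrow> \<chi> f \<in> dp_algebra m"
  shows "diff_hom m \<delta> (\<lambda>f. \<psi> (\<chi> f))"
  using assms by (simp add: diff_hom_def)

lemma diff_hom_id: "diff_hom m \<delta> (\<lambda>f. f)"
  by (simp add: diff_hom_def)

lemma diff_hom_restrict: "diff_hom m \<delta> (restrict \<psi> (dp_algebra m)) \<longleftrightarrow> diff_hom m \<delta> \<psi>"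
  by (simp add: diff_hom_def diff_polys_add diff_polys_mult diff_polys_D)

lemma diff_hom_inverse:
  assumes \<phi>: "\<phi> \<in> dp_auto m \<delta>"
  shows "diff_hom m \<delta> (inv_into (dp_algebra m) \<phi>)"
proof -
  let ?A = "dp_algebra m"
  let ?\<psi> = "inv_into ?A \<phi>"
  have bij: "bij_betw \<phi> ?A ?A" and hom: "diff_hom m \<delta> \<phi>"
    using \<phi> by (auto simp: dp_auto_iff Bij_def)
  have mem: "?\<psi> f \<in> ?A" and inv: "\<phi> (?\<psi> f) = f" if "f \<in> ?A" for f
    using that bij by (metis bij_betw_def inv_into_into, metis bij_betw_inv_into_right)
  have inv': "?\<psi> (\<phi> f) = f" if "f \<in> ?A" for f
    using that bij by (metis bij_betw_inv_into_left)
  have eq: "?\<psi> f = g" if "g \<in> ?A" "\<phi> g = f" for f g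
    using inv'[OF that(1)] that(2) by simp
  show ?thesis
    unfolding diff_hom_def
    by (intro conjI ballI allI eq)
      (simp_all add: diff_homD[OF hom] mem inv diff_polys_add diff_polys_mult diff_polys_D)
qed

lemma subgroup_dp_auto: "subgroup (dp_auto m \<delta>) (BijGroup (dp_algebra m))"
proof (rule group.subgroupI[OF group_BijGroup])
  show "dp_auto m \<delta> \<subseteq> carrier (BijGroup (dp_algebra m))"
    by (auto simp: dp_auto_iff BijGroup_def)
  have "(\<lambda>f\<in>dp_algebra m. f) \<in> dp_auto m \<delta>"
    using diff_hom_restrict[of m "\<lambda>f. f"] by (simp add: dp_auto_iff id_Bij diff_hom_id)
  then show "dp_auto m \<delta> \<noteq> {}" by blast
  fix \<phi> assume \<phi>: "\<phi> \<in> dp_auto m \<delta>"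
  then have "\<phi> \<in> Bij (dp_algebra m)" by (simp add: dp_auto_iff)
  with diff_hom_inverse[OF \<phi>] show "inv\<^bsub>BijGroup (dp_algebra m)\<^esub> \<phi> \<in> dp_auto m \<delta>"
    by (simp add: inv_BijGroup dp_auto_iff restrict_inv_into_Bij diff_hom_restrict)
  fix \<psi> assume \<psi>: "\<psi> \<in> dp_auto m \<delta>"
  have "diff_hom m \<delta> (\<lambda>f. \<phi> (\<psi> f))"
    using \<phi> \<psi> dp_auto_mem[OF \<psi>] by (simp add: diff_hom_compose dp_auto_iff)
  moreover have "\<phi> \<otimes>\<^bsub>BijGroup (dp_algebra m)\<^esub> \<psi> = compose (dp_algebra m) \<phi> \<psi>"
    using \<phi> \<psi> by (simp add: BijGroup_def dp_auto_iff)
  moreover have "compose (dp_algebra m) \<phi> \<psi> \<in> Bij (dp_algebra m)"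
    using \<phi> \<psi> by (simp add: compose_Bij dp_auto_iff)
  ultimately show "\<phi> \<otimes>\<^bsub>BijGroup (dp_algebra m)\<^esub> \<psi> \<in> dp_auto m \<delta>"
    by (simp only: dp_auto_iff) (simp add: compose_def diff_hom_restrict)
qed

lemma dp_AutoGroup_mult:
  "\<phi> \<in> dp_auto m \<delta> \<Longrightarrow> \<psi> \<in> dp_auto m \<delta> \<Longrightarrow>
    \<phi> \<otimes>\<^bsub>dp_AutoGroup m \<delta>\<^esub> \<psi> = compose (dp_algebra m) \<phi> \<psi>"
  by (simp add: dp_AutoGroup_def BijGroup_def dp_auto_iff)

lemma group_dp_AutoGroup: "group (dp_AutoGroup m \<delta>)"
  unfolding dp_AutoGroup_def
  by (rule subgroup.subgroup_is_group[OF subgroup_dp_auto group_BijGroup])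

lemma carrier_dp_AutoGroup [simp]: "carrier (dp_AutoGroup m \<delta>) = dp_auto m \<delta>"
  by (simp add: dp_AutoGroup_def)

lemma inv_dp_AutoGroup:
  assumes "\<phi> \<in> dp_auto m \<delta>"
  shows "inv\<^bsub>dp_AutoGroup m \<delta>\<^esub> \<phi> = restrict (inv_into (dp_algebra m) \<phi>) (dp_algebra m)"
proof -
  have "\<phi> \<in> Bij (dp_algebra m)" using assms by (simp add: dp_auto_iff)
  then show ?thesis
    unfolding dp_AutoGroup_def
    by (simp add: group.m_inv_consistent[OF group_BijGroup subgroup_dp_auto assms] inv_BijGroup)
qed

text \<open>
  The parameters \<open>z\<close> and \<open>z'\<close> allow the two symmetric kinds of elementary automorphisms to be
  treated by one argument.
\<close>

definition elementary_in :: "nat \<Rightarrow> indet \<Rightarrow> indet \<Rightarrow> ('k dpoly \<Rightarrow> 'k dpoly) \<Rightarrow> bool" where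
  "elementary_in m z z' \<phi> \<longleftrightarrow> \<phi> \<in> dp_auto m \<delta> \<and> \<phi> (dp_var (z', {#})) = dp_var (z', {#}) \<and>
     (\<exists>a f. a \<noteq> 0 \<and> f \<in> diff_polys m {z'} \<and> \<phi> (dp_var (z, {#})) = Const a * dp_var (z, {#}) + f)"

lemma elementary_autos_iff:
  "\<phi> \<in> elementary_autos m \<delta> \<longleftrightarrow> elementary_in m X Y \<phi> \<or> elementary_in m Y X \<phi>"
  by (auto simp: elementary_autos_def elementary_in_def auto_pair_def dp_x_def dp_y_def)

lemma elementary_in_inverse:
  assumes "elementary_in m z z' \<phi>"
  shows "elementary_in m z z' (inv\<^bsub>dp_AutoGroup m \<delta>\<^esub> \<phi>)"
proof -
  let ?A = "dp_algebra m"
  let ?x = "dp_var (z, {#}) :: 'k dpoly" and ?y = "dp_var (z', {#}) :: 'k dpoly"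
  obtain a f where \<phi>: "\<phi> \<in> dp_auto m \<delta>" and y: "\<phi> ?y = ?y"
    and a: "a \<noteq> 0" and f: "f \<in> diff_polys m {z'}" and x: "\<phi> ?x = Const a * ?x + f"
    using assms by (auto simp: elementary_in_def)
  define \<psi> where "\<psi> = inv\<^bsub>dp_AutoGroup m \<delta>\<^esub> \<phi>"
  have \<psi>: "\<psi> \<in> dp_auto m \<delta>"
    unfolding \<psi>_def using group.inv_closed[OF group_dp_AutoGroup, of \<phi>] \<phi> by simp
  then have hom: "diff_hom m \<delta> \<psi>" by (simp add: dp_auto_iff)
  have inv: "\<psi> (\<phi> g) = g" if "g \<in> ?A" for g
    unfolding \<psi>_def inv_dp_AutoGroup[OF \<phi>]
    using that \<phi> dp_auto_mem[OF \<phi> that] bij_betw_inv_into_left[of \<phi> ?A ?A g]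
    by (simp add: dp_auto_iff Bij_def)
  have \<psi>_y: "\<psi> ?y = ?y" using inv[of ?y] y by simp
  have "\<psi> f = f"
    using hom diff_hom_id f by (rule diff_hom_eqI) (simp add: \<psi>_y)
  moreover have "\<psi> (Const a * ?x + f) = ?x" using inv[of ?x] x by simp
  ultimately have "Const a * \<psi> ?x = ?x - f"
    using diff_polys_subset_algebra[OF f]
    by (simp add: diff_homD[OF hom] diff_polys_mult eq_diff_eq)
  then have "Const (1 / a) * (Const a * \<psi> ?x) = Const (1 / a) * (?x - f)" by simp
  then have "\<psi> ?x = Const (1 / a) * ?x + Const (- 1 / a) * f"
    using a by (simp add: right_diff_distrib Const_minus flip: mult.assoc Const_mult)
  moreover have "Const (- 1 / a) * f \<in> diff_polys m {z'}"
    using f by (simp add: diff_polys_mult)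
  ultimately have "elementary_in m z z' \<psi>"
    using \<psi> \<psi>_y a unfolding elementary_in_def by (metis divide_eq_0_iff zero_neq_one)
  then show ?thesis by (simp add: \<psi>_def)
qed

text \<open>
  The substitution \<open>z \<mapsto> z + H\<close> is invertible because it fixes \<open>H\<close>: its inverse is \<open>z \<mapsto> z - H\<close>.
\<close>

lemma translation_exists:
  assumes "z \<noteq> z'" and H: "H \<in> diff_polys m {z'}"
  obtains \<epsilon> where "\<epsilon> \<in> dp_auto m \<delta>" "\<epsilon> (dp_var (z, {#})) = dp_var (z, {#}) + H"
    "\<epsilon> (dp_var (z', {#})) = dp_var (z', {#})"
proof -
  let ?A = "dp_algebra m :: 'k dpoly set"
  define E where "E H = dsubst (\<lambda>t. if t = z then dp_var (t, {#}) + H else dp_var (t, {#}))" for H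
  have E_var: "E H (dp_var (t, {#})) = (if t = z then dp_var (t, {#}) + H else dp_var (t, {#}))" for H t
    by (simp add: E_def dsubst_var)
  have hom: "diff_hom m \<delta> (E H)" for H
    by (simp add: E_def diff_hom_dsubst)
  have mem: "E H f \<in> ?A" if H: "H \<in> diff_polys m {z'}" and f: "f \<in> ?A" for H f
    using f
  proof (rule diff_polys_induct[where P = "\<lambda>f. E H f \<in> ?A"])
    fix t show "E H (dp_var (t, {#})) \<in> ?A"
      by (simp add: E_var diff_polys_add diff_polys_subset_algebra[OF H])
  qed (simp_all add: diff_homD[OF hom] diff_polys_add diff_polys_mult diff_polys_D)
  have inv: "E H (E (- H) f) = f" if H: "H \<in> diff_polys m {z'}" and f: "f \<in> ?A" for H f
  proof -
    have H': "- H \<in> diff_polys m {z'}" using H by (rule diff_polys_uminus)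
    have "E H (- H) = - H"
      using hom diff_hom_id H' by (rule diff_hom_eqI) (use \<open>z \<noteq> z'\<close> in \<open>auto simp: E_var\<close>)
    then have "E H (E (- H) (dp_var (t, {#}))) = dp_var (t, {#})" for t
      using diff_homD(1)[OF hom, of "dp_var (t, {#})" "- H" H] diff_polys_subset_algebra[OF H']
      by (cases "t = z") (simp_all add: E_var)
    then show ?thesis
      by (intro diff_hom_eqI[OF diff_hom_compose[OF hom hom mem[OF H']] diff_hom_id f])
  qed
  have H': "- H \<in> diff_polys m {z'}" using H by (rule diff_polys_uminus)
  have "bij_betw (E H) ?A ?A"
    using mem[OF H] mem[OF H'] inv[OF H] inv[OF H']
    by (intro bij_betw_byWitness[where f' = "E (- H)"]) auto
  then have "restrict (E H) ?A \<in> dp_auto m \<delta>"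
    by (simp add: dp_auto_iff Bij_def diff_hom_restrict hom)
  then show thesis
    using \<open>z \<noteq> z'\<close> by (intro that[of "restrict (E H) ?A"]) (simp_all add: E_var)
qed

section \<open>Tame automorphisms\<close>

definition standard_pair :: "nat \<Rightarrow> 'k dpoly \<times> 'k dpoly \<Rightarrow> bool" where
  "standard_pair m p \<longleftrightarrow> (\<exists>q. basic_pair m \<delta> q \<and> affine_image q p)"

lemma standard_pair_swap: "standard_pair m (f, g) \<longleftrightarrow> standard_pair m (g, f)"
  unfolding standard_pair_def using affine_image_trans affine_image_swap by blast

lemma standard_pair_transform:
  "standard_pair m (f, g) \<Longrightarrow> \<alpha> \<noteq> 0 \<Longrightarrow> h \<in> diff_subalgebra m \<delta> g \<Longrightarrow> standard_pair m (Const \<alpha> * f + h, g)"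
  unfolding standard_pair_def using basic_pair_transform by blast

lemma standard_pair_elementary:
  assumes \<psi>: "\<psi> \<in> dp_auto m \<delta>" and el: "elementary_in m z z' \<phi>"
    and std: "standard_pair m (\<psi> (dp_var (z, {#})), \<psi> (dp_var (z', {#})))"
  shows "standard_pair m (\<psi> (\<phi> (dp_var (z, {#}))), \<psi> (\<phi> (dp_var (z', {#}))))"
proof -
  from el obtain a f where y: "\<phi> (dp_var (z', {#})) = dp_var (z', {#})" and a: "a \<noteq> 0"
    and f: "f \<in> diff_polys m {z'}" and x: "\<phi> (dp_var (z, {#})) = Const a * dp_var (z, {#}) + f"
    by (auto simp: elementary_in_def)
  have hom: "diff_hom m \<delta> \<psi>" using \<psi> by (simp add: dp_auto_iff)
  have "\<psi> f \<in> diff_subalgebra m \<delta> (\<psi> (dp_var (z', {#})))"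
    using f diff_hom_image[OF hom dp_var_algebra[of z']] by (auto simp: diff_subalgebra_var)
  moreover have "\<psi> (\<phi> (dp_var (z, {#}))) = Const a * \<psi> (dp_var (z, {#})) + \<psi> f"
    unfolding x using diff_polys_subset_algebra[OF f] by (simp add: diff_homD[OF hom] diff_polys_mult)
  ultimately show ?thesis using standard_pair_transform[OF std a] by (simp add: y)
qed

lemma standard_pair_mult:
  assumes \<psi>: "\<psi> \<in> dp_auto m \<delta>" "standard_pair m (auto_pair \<psi>)" and \<phi>: "\<phi> \<in> elementary_autos m \<delta>"
  shows "standard_pair m (auto_pair (\<psi> \<otimes>\<^bsub>dp_AutoGroup m \<delta>\<^esub> \<phi>))"
proof -
  have "\<phi> \<in> dp_auto m \<delta>" using \<phi> by (simp add: elementary_autos_def)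
  then have "auto_pair (\<psi> \<otimes>\<^bsub>dp_AutoGroup m \<delta>\<^esub> \<phi>)
      = (\<psi> (\<phi> (dp_var (X, {#}))), \<psi> (\<phi> (dp_var (Y, {#}))))"
    using \<psi>(1) by (simp add: dp_AutoGroup_mult auto_pair_def compose_def dp_x_def dp_y_def)
  moreover have "standard_pair m \<dots>"
    using \<phi> \<psi>(2) standard_pair_elementary[OF \<psi>(1), of X Y \<phi>] standard_pair_elementary[OF \<psi>(1), of Y X \<phi>]
    by (auto simp: elementary_autos_iff auto_pair_def dp_x_def dp_y_def standard_pair_swap)
  ultimately show ?thesis by simp
qed

text \<open>
  The induction over the generated subgroup needs a statement about right multiplication by \<open>\<phi>\<close>,
  since the pair of \<open>\<psi> \<circ> \<phi>\<close> for elementary \<open>\<phi>\<close> is an elementary transformation of the pair of \<open>\<psi>\<close>,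
  whereas the pair of \<open>\<phi> \<circ> \<psi>\<close> is not.
\<close>

lemma tame_standard_pair:
  assumes "\<phi> \<in> tame_autos m \<delta>"
  shows "\<phi> \<in> dp_auto m \<delta>" "standard_pair m (auto_pair \<phi>)"
proof -
  interpret G: group "dp_AutoGroup m \<delta>" by (rule group_dp_AutoGroup)
  have sub: "elementary_autos m \<delta> \<subseteq> carrier (dp_AutoGroup m \<delta>)"
    by (auto simp: elementary_autos_def)
  have "\<phi> \<in> dp_auto m \<delta> \<and> (\<forall>\<psi>\<in>dp_auto m \<delta>. standard_pair m (auto_pair \<psi>) \<longrightarrow>
      standard_pair m (auto_pair (\<psi> \<otimes>\<^bsub>dp_AutoGroup m \<delta>\<^esub> \<phi>)))"
    using assms unfolding tame_autos_def
  proof (induction rule: generate.induct)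
    case one
    show ?case using G.one_closed G.r_one by simp
  next
    case (incl \<phi>)
    then show ?case using sub standard_pair_mult by auto
  next
    case (inv \<phi>)
    then have "inv\<^bsub>dp_AutoGroup m \<delta>\<^esub> \<phi> \<in> elementary_autos m \<delta>"
      using elementary_in_inverse by (auto simp: elementary_autos_iff)
    then show ?case using sub standard_pair_mult by auto
  next
    case (eng \<phi> \<chi>)
    have "\<psi> \<otimes>\<^bsub>dp_AutoGroup m \<delta>\<^esub> (\<phi> \<otimes>\<^bsub>dp_AutoGroup m \<delta>\<^esub> \<chi>)
        = (\<psi> \<otimes>\<^bsub>dp_AutoGroup m \<delta>\<^esub> \<phi>) \<otimes>\<^bsub>dp_AutoGroup m \<delta>\<^esub> \<chi>" if "\<psi> \<in> dp_auto m \<delta>" for \<psi>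
      using eng.IH that G.m_assoc[of \<psi> \<phi> \<chi>] by simp
    then show ?case using eng.IH G.m_closed by simp
  qed
  moreover have one: "\<one>\<^bsub>dp_AutoGroup m \<delta>\<^esub> \<in> dp_auto m \<delta>" using G.one_closed by simp
  moreover have "standard_pair m (auto_pair \<one>\<^bsub>dp_AutoGroup m \<delta>\<^esub>)"
  proof -
    have "auto_pair \<one>\<^bsub>dp_AutoGroup m \<delta>\<^esub> = (dp_x, dp_y)"
      by (simp add: auto_pair_def dp_AutoGroup_def BijGroup_def dp_x_def dp_y_def)
    then show ?thesis unfolding standard_pair_def
      using basic_pair.base affine_image_refl by metis
  qed
  ultimately show "\<phi> \<in> dp_auto m \<delta>" "standard_pair m (auto_pair \<phi>)"
    using G.l_one[of \<phi>] by auto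
qed

text \<open>
  An elementary transformation of the pair of an automorphism is again the pair of an
  automorphism, namely of the composition with a translation.
\<close>

lemma translate_auto:
  assumes \<phi>: "\<phi> \<in> dp_auto m \<delta>" and "z \<noteq> z'"
    and h: "h \<in> diff_subalgebra m \<delta> (\<phi> (dp_var (z', {#})))"
  obtains \<chi> where "\<chi> \<in> dp_auto m \<delta>" "\<chi> (dp_var (z, {#})) = \<phi> (dp_var (z, {#})) + h"
    "\<chi> (dp_var (z', {#})) = \<phi> (dp_var (z', {#}))"
proof -
  have hom: "diff_hom m \<delta> \<phi>" using \<phi> by (simp add: dp_auto_iff)
  obtain H where H: "H \<in> diff_polys m {z'}" "h = \<phi> H"
    using h diff_hom_image[OF hom dp_var_algebra[of z']] by (auto simp: diff_subalgebra_var)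
  obtain \<epsilon> where \<epsilon>: "\<epsilon> \<in> dp_auto m \<delta>" "\<epsilon> (dp_var (z, {#})) = dp_var (z, {#}) + H"
    "\<epsilon> (dp_var (z', {#})) = dp_var (z', {#})"
    using translation_exists[OF \<open>z \<noteq> z'\<close> H(1)] .
  have "\<phi> \<otimes>\<^bsub>dp_AutoGroup m \<delta>\<^esub> \<epsilon> \<in> dp_auto m \<delta>"
    using monoid.m_closed[OF group.is_monoid[OF group_dp_AutoGroup], of \<phi> m \<epsilon>] \<phi> \<epsilon>(1) by simp
  then have "compose (dp_algebra m) \<phi> \<epsilon> \<in> dp_auto m \<delta>"
    by (simp add: dp_AutoGroup_mult \<phi> \<epsilon>(1))
  then show thesis
    by (rule that)
      (simp_all add: compose_def \<epsilon>(2,3) diff_homD[OF hom] H(2) diff_polys_subset_algebra[OF H(1)])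
qed

lemma tame_reducible:
  assumes tame: "\<phi> \<in> tame_autos m \<delta>" and "\<phi> \<notin> affine_autos m \<delta>"
  shows "elementarily_reducible m \<delta> \<phi>"
proof -
  let ?f = "\<phi> dp_x" and ?g = "\<phi> dp_y"
  have \<phi>: "\<phi> \<in> dp_auto m \<delta>" using tame by (rule tame_standard_pair)
  obtain q where q: "basic_pair m \<delta> q" "affine_image q (?f, ?g)"
    using tame_standard_pair(2)[OF tame] by (auto simp: standard_pair_def auto_pair_def)
  have "q \<noteq> (dp_x, dp_y)"
  proof
    assume "q = (dp_x, dp_y)"
    then have "\<phi> \<in> affine_autos m \<delta>"
      using q(2) \<phi> by (simp add: affine_image_def affine_autos_def auto_pair_def)
    with assms(2) show False ..
  qed
  with q(1) have "reducible_pair m q" using basic_pair_reducible by blast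
  from affine_image_reduces[OF this q(2)] show ?thesis
  proof (elim disjE bexE)
    fix h assume h: "h \<in> diff_subalgebra m \<delta> ?g" "dp_deg (?f + h) < dp_deg ?f"
    obtain \<chi> where "\<chi> \<in> dp_auto m \<delta>" "\<chi> dp_x = ?f + h" "\<chi> dp_y = ?g"
      using translate_auto[OF \<phi>, of X Y h] h(1) by (auto simp: dp_x_def dp_y_def)
    then show ?thesis using h
      unfolding elementarily_reducible_def elementary_transformation_def auto_deg_def auto_pair_def
      by (intro bexI[of _ \<chi>]) (auto intro!: exI[of _ 1] exI[of _ h])
  next
    fix h assume h: "h \<in> diff_subalgebra m \<delta> ?f" "dp_deg (?g + h) < dp_deg ?g"
    obtain \<chi> where "\<chi> \<in> dp_auto m \<delta>" "\<chi> dp_y = ?g + h" "\<chi> dp_x = ?f"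
      using translate_auto[OF \<phi>, of Y X h] h(1) by (auto simp: dp_x_def dp_y_def)
    then show ?thesis using h
      unfolding elementarily_reducible_def elementary_transformation_def auto_deg_def auto_pair_def
      by (intro bexI[of _ \<chi>]) (auto intro!: exI[of _ 1] exI[of _ h])
  qed
qed

end

section \<open>Extending the derivations to all indices\<close>

lemma dp_deriv_cong: "\<delta> i = \<delta>' i \<Longrightarrow> dp_deriv \<delta> i = dp_deriv \<delta>' i"
  by (simp add: dp_deriv_def fun_eq_iff)

lemma diff_subalgebra_cong:
  assumes "\<And>i. i \<in> {1..m} \<Longrightarrow> \<delta> i = \<delta>' i"
  shows "diff_subalgebra m \<delta> f = diff_subalgebra m \<delta>' f"
proof -
  have "g \<in> diff_subalgebra m \<delta>' f"
    if "g \<in> diff_subalgebra m \<delta> f" "\<And>i. i \<in> {1..m} \<Longrightarrow> \<delta> i = \<delta>' i" for g \<delta> \<delta>'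
    using that(1)
  proof induction
    case (deriv g i)
    have "dp_deriv \<delta> i = dp_deriv \<delta>' i"
      by (rule dp_deriv_cong) (rule that(2)[OF deriv.hyps(2)])
    with deriv show ?case
      using diff_subalgebra.deriv[of g m \<delta>' f i] by simp
  qed (auto intro: diff_subalgebra.intros)
  from this[of _ \<delta> \<delta>'] this[of _ \<delta>' \<delta>] assms show ?thesis by auto
qed

theorem mainTheorem2:
  fixes m :: nat
    and \<delta> :: "nat \<Rightarrow> 'k::field_char_0 \<Rightarrow> 'k"
    and \<phi> :: "'k dpoly \<Rightarrow> 'k dpoly"
  assumes "differential_field m \<delta>"
    and "\<phi> \<in> tame_autos m \<delta>"
    and "\<phi> \<notin> affine_autos m \<delta>"
  shows "elementarily_reducible m \<delta> \<phi>"
proof -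
  define \<delta>' where "\<delta>' i = (if i \<in> {1..m} then \<delta> i else (\<lambda>_. 0))" for i
  have cong: "\<And>i. i \<in> {1..m} \<Longrightarrow> \<delta> i = \<delta>' i" by (simp add: \<delta>'_def)
  have zero: "\<delta> i 0 = 0" if "i \<in> {1..m}" for i
  proof -
    have "\<delta> i (0 + 0) = \<delta> i 0 + \<delta> i 0"
      using assms(1) that unfolding differential_field_def derivation_def by blast
    then show ?thesis by simp
  qed
  interpret commuting_derivations \<delta>'
    by standard
      (use assms(1) zero in \<open>auto simp: \<delta>'_def differential_field_def derivation_def\<close>)
  have "dp_deriv \<delta> i = dp_deriv \<delta>' i" if "i \<in> {1..m}" for i
    by (rule dp_deriv_cong) (rule cong[OF that])
  then have auto: "dp_auto m \<delta> = dp_auto m \<delta>'"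
    by (simp add: dp_auto_def)
  have "tame_autos m \<delta> = tame_autos m \<delta>'" "affine_autos m \<delta> = affine_autos m \<delta>'"
    by (simp_all add: tame_autos_def dp_AutoGroup_def elementary_autos_def affine_autos_def auto)
  moreover have "elementarily_reducible m \<delta> \<phi> = elementarily_reducible m \<delta>' \<phi>"
  proof -
    have "diff_subalgebra m \<delta> = diff_subalgebra m \<delta>'"
      by (rule ext) (rule diff_subalgebra_cong[OF cong])
    then show ?thesis
      by (simp only: elementarily_reducible_def elementary_transformation_def auto)
  qed
  ultimately show ?thesis using tame_reducible assms(2,3) by simp
qed

end
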